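(* $\Sigma^1_1$-$\mathsf{NCE}$ is provable in $\Pi^1_1$-$\mathsf{CA}_0$.
   Context: A formula $\varphi(X)$ of second-order arithmetic with one free set variable (possibly with set parameters) is of finite character if $\varphi(\emptyset)$ holds and, for every set $A$, $\varphi(A)$ holds iff $\varphi(F)$ holds for every finite $F \subseteq A$. A nondeterministic finitary closure operator is a sequence $N$ of pairs $\langle F, S\rangle$ where $F$ is (the canonical index of) a finite, possibly empty, subset of $\mathbb{N}$ and $S$ is a nonempty subset of $\mathbb{N}$; a set $A \subseteq \mathbb{N}$ is $N$-closed if for each $\langle F,S\rangle$ in $N$ with $F \subseteq A$ we have $A \cap S \neq \emptyset$. $\Sigma^1_1$-$\mathsf{NCE}$ is the scheme: if $N$ is a nondeterministic finitary closure operator, $\varphi$ is a $\Sigma^1_1$ formula of finite character, and $A$ is any set, then every $N$-closed subset of $A$ satisfying $\varphi$ is contained in a $\subseteq$-maximal $N$-closed subset of $A$ satisfying $\varphi$. *)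

theory Defs
  imports Main
begin

section \<open>The language of second-order arithmetic\<close>

text \<open>
  Number variables and set variables are two independent families of de Bruijn indices: a number
  quantifier does not shift set indices and vice versa. Set variables are the only set terms.
  Equality is primitive for numbers only; for sets it is extensional equality. The remaining
  connectives and the existential quantifiers are the usual classical abbreviations.
\<close>

datatype tm =
    Var nat (\<open>\<^bold>v\<close>)
  | Zero (\<open>\<^bold>0\<close>)
  | One (\<open>\<^bold>1\<close>)
  | Add tm tm (infixl \<open>\<^bold>+\<close> 85)
  | Mul tm tm (infixl \<open>\<^bold>*\<close> 90)

datatype fm =
    Fls (\<open>\<^bold>\<bottom>\<close>)
  | Eq tm tm (infix \<open>\<^bold>=\<close> 80)
  | Less tm tm (infix \<open>\<^bold><\<close> 80)
  | Mem tm nat (infix \<open>\<^bold>\<in>\<close> 80)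
  | Imp fm fm (infixr \<open>\<^bold>\<longrightarrow>\<close> 55)
  | AllN fm
  | AllS fm

abbreviation Neg :: "fm \<Rightarrow> fm" (\<open>\<^bold>\<not> _\<close> [70] 70) where
  "\<^bold>\<not> \<phi> \<equiv> \<phi> \<^bold>\<longrightarrow> \<^bold>\<bottom>"

abbreviation Or :: "fm \<Rightarrow> fm \<Rightarrow> fm" (infixr \<open>\<^bold>\<or>\<close> 60) where
  "\<phi> \<^bold>\<or> \<psi> \<equiv> \<^bold>\<not> \<phi> \<^bold>\<longrightarrow> \<psi>"

abbreviation And :: "fm \<Rightarrow> fm \<Rightarrow> fm" (infixr \<open>\<^bold>\<and>\<close> 65) where
  "\<phi> \<^bold>\<and> \<psi> \<equiv> \<^bold>\<not> (\<phi> \<^bold>\<longrightarrow> \<^bold>\<not> \<psi>)"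

abbreviation Iff :: "fm \<Rightarrow> fm \<Rightarrow> fm" (infix \<open>\<^bold>\<longleftrightarrow>\<close> 50) where
  "\<phi> \<^bold>\<longleftrightarrow> \<psi> \<equiv> (\<phi> \<^bold>\<longrightarrow> \<psi>) \<^bold>\<and> (\<psi> \<^bold>\<longrightarrow> \<phi>)"

abbreviation ExN :: "fm \<Rightarrow> fm" where
  "ExN \<phi> \<equiv> \<^bold>\<not> (AllN (\<^bold>\<not> \<phi>))"

abbreviation ExS :: "fm \<Rightarrow> fm" where
  "ExS \<phi> \<equiv> \<^bold>\<not> (AllS (\<^bold>\<not> \<phi>))"

primrec subst_tm :: "(nat \<Rightarrow> tm) \<Rightarrow> tm \<Rightarrow> tm" where
  "subst_tm \<sigma> (\<^bold>v i) = \<sigma> i"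
| "subst_tm \<sigma> \<^bold>0 = \<^bold>0"
| "subst_tm \<sigma> \<^bold>1 = \<^bold>1"
| "subst_tm \<sigma> (s \<^bold>+ t) = subst_tm \<sigma> s \<^bold>+ subst_tm \<sigma> t"
| "subst_tm \<sigma> (s \<^bold>* t) = subst_tm \<sigma> s \<^bold>* subst_tm \<sigma> t"

definition lift_tm :: "nat \<Rightarrow> tm \<Rightarrow> tm" where
  "lift_tm k = subst_tm (\<lambda>i. \<^bold>v (i + k))"

text \<open>Simultaneous capture-avoiding substitution of terms for the free number variables
  and of set variables for the free set variables.\<close>

primrec subst :: "(nat \<Rightarrow> tm) \<Rightarrow> (nat \<Rightarrow> nat) \<Rightarrow> fm \<Rightarrow> fm" where
  "subst \<sigma> \<rho> \<^bold>\<bottom> = \<^bold>\<bottom>"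
| "subst \<sigma> \<rho> (s \<^bold>= t) = (subst_tm \<sigma> s \<^bold>= subst_tm \<sigma> t)"
| "subst \<sigma> \<rho> (s \<^bold>< t) = (subst_tm \<sigma> s \<^bold>< subst_tm \<sigma> t)"
| "subst \<sigma> \<rho> (t \<^bold>\<in> X) = (subst_tm \<sigma> t \<^bold>\<in> \<rho> X)"
| "subst \<sigma> \<rho> (\<phi> \<^bold>\<longrightarrow> \<psi>) = (subst \<sigma> \<rho> \<phi> \<^bold>\<longrightarrow> subst \<sigma> \<rho> \<psi>)"
| "subst \<sigma> \<rho> (AllN \<phi>) = AllN (subst (case_nat (\<^bold>v 0) (\<lambda>i. lift_tm 1 (\<sigma> i))) \<rho> \<phi>)"
| "subst \<sigma> \<rho> (AllS \<phi>) = AllS (subst \<sigma> (case_nat 0 (\<lambda>i. Suc (\<rho> i))) \<phi>)"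

definition liftN :: "fm \<Rightarrow> fm" where
  "liftN = subst (\<lambda>i. \<^bold>v (Suc i)) id"

definition liftS :: "fm \<Rightarrow> fm" where
  "liftS = subst \<^bold>v Suc"

definition instN :: "tm \<Rightarrow> fm \<Rightarrow> fm" where
  "instN t = subst (case_nat t \<^bold>v) id"

definition instS :: "nat \<Rightarrow> fm \<Rightarrow> fm" where
  "instS X = subst \<^bold>v (case_nat X id)"

primrec arithmetical :: "fm \<Rightarrow> bool" where
  "arithmetical \<^bold>\<bottom> \<longleftrightarrow> True"
| "arithmetical (s \<^bold>= t) \<longleftrightarrow> True"
| "arithmetical (s \<^bold>< t) \<longleftrightarrow> True"
| "arithmetical (t \<^bold>\<in> X) \<longleftrightarrow> True"
| "arithmetical (\<phi> \<^bold>\<longrightarrow> \<psi>) \<longleftrightarrow> arithmetical \<phi> \<and> arithmetical \<psi>"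
| "arithmetical (AllN \<phi>) \<longleftrightarrow> arithmetical \<phi>"
| "arithmetical (AllS \<phi>) \<longleftrightarrow> False"

definition Sigma11 :: "fm \<Rightarrow> bool" where
  "Sigma11 \<phi> \<longleftrightarrow> (\<exists>\<theta>. arithmetical \<theta> \<and> \<phi> = ExS \<theta>)"

definition Pi11 :: "fm \<Rightarrow> bool" where
  "Pi11 \<phi> \<longleftrightarrow> (\<exists>\<theta>. arithmetical \<theta> \<and> \<phi> = AllS \<theta>)"


section \<open>Provability\<close>

text \<open>
  Classical two-sorted natural deduction with equality. In \<open>deriv T \<Gamma> \<phi>\<close>, \<open>T\<close> is the set of
  nonlogical axioms and \<open>\<Gamma>\<close> the set of open hypotheses. The eigenvariable condition of the
  generalization rules constrains \<open>\<Gamma>\<close> only, so an axiom with free variables stands for its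
  universal closure, and a formula is provable iff its universal closure is.
\<close>

inductive deriv :: "fm set \<Rightarrow> fm set \<Rightarrow> fm \<Rightarrow> bool" for T :: "fm set" where
  axm: "\<phi> \<in> T \<Longrightarrow> deriv T \<Gamma> \<phi>"
| hyp: "\<phi> \<in> \<Gamma> \<Longrightarrow> deriv T \<Gamma> \<phi>"
| impI: "deriv T (insert \<phi> \<Gamma>) \<psi> \<Longrightarrow> deriv T \<Gamma> (\<phi> \<^bold>\<longrightarrow> \<psi>)"
| impE: "deriv T \<Gamma> (\<phi> \<^bold>\<longrightarrow> \<psi>) \<Longrightarrow> deriv T \<Gamma> \<phi> \<Longrightarrow> deriv T \<Gamma> \<psi>"
| raa: "deriv T (insert (\<^bold>\<not> \<phi>) \<Gamma>) \<^bold>\<bottom> \<Longrightarrow> deriv T \<Gamma> \<phi>"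
| allNI: "deriv T (liftN ` \<Gamma>) \<phi> \<Longrightarrow> deriv T \<Gamma> (AllN \<phi>)"
| allNE: "deriv T \<Gamma> (AllN \<phi>) \<Longrightarrow> deriv T \<Gamma> (instN t \<phi>)"
| allSI: "deriv T (liftS ` \<Gamma>) \<phi> \<Longrightarrow> deriv T \<Gamma> (AllS \<phi>)"
| allSE: "deriv T \<Gamma> (AllS \<phi>) \<Longrightarrow> deriv T \<Gamma> (instS X \<phi>)"
| eqI: "deriv T \<Gamma> (t \<^bold>= t)"
| eqE: "deriv T \<Gamma> (s \<^bold>= t) \<Longrightarrow> deriv T \<Gamma> (instN s \<phi>) \<Longrightarrow> deriv T \<Gamma> (instN t \<phi>)"

definition provable :: "fm set \<Rightarrow> fm \<Rightarrow> bool" (infix \<open>\<turnstile>\<close> 45) where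
  "T \<turnstile> \<phi> \<longleftrightarrow> deriv T {} \<phi>"


section \<open>The system of \<open>\<Pi>\<^sup>1\<^sub>1\<close> comprehension\<close>

definition basic_axioms :: "fm set" where
  "basic_axioms =
    {\<^bold>\<not> (\<^bold>v 0 \<^bold>+ \<^bold>1 \<^bold>= \<^bold>0),
     \<^bold>v 0 \<^bold>+ \<^bold>1 \<^bold>= \<^bold>v 1 \<^bold>+ \<^bold>1 \<^bold>\<longrightarrow> \<^bold>v 0 \<^bold>= \<^bold>v 1,
     \<^bold>v 0 \<^bold>+ \<^bold>0 \<^bold>= \<^bold>v 0,
     \<^bold>v 0 \<^bold>+ (\<^bold>v 1 \<^bold>+ \<^bold>1) \<^bold>= (\<^bold>v 0 \<^bold>+ \<^bold>v 1) \<^bold>+ \<^bold>1,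
     \<^bold>v 0 \<^bold>* \<^bold>0 \<^bold>= \<^bold>0,
     \<^bold>v 0 \<^bold>* (\<^bold>v 1 \<^bold>+ \<^bold>1) \<^bold>= \<^bold>v 0 \<^bold>* \<^bold>v 1 \<^bold>+ \<^bold>v 0,
     \<^bold>\<not> (\<^bold>v 0 \<^bold>< \<^bold>0),
     \<^bold>v 0 \<^bold>< \<^bold>v 1 \<^bold>+ \<^bold>1 \<^bold>\<longleftrightarrow> \<^bold>v 0 \<^bold>< \<^bold>v 1 \<^bold>\<or> \<^bold>v 0 \<^bold>= \<^bold>v 1}"

definition induction_axiom :: fm where
  "induction_axiom =
    (\<^bold>0 \<^bold>\<in> 0 \<^bold>\<and> AllN (\<^bold>v 0 \<^bold>\<in> 0 \<^bold>\<longrightarrow> \<^bold>v 0 \<^bold>+ \<^bold>1 \<^bold>\<in> 0) \<^bold>\<longrightarrow> AllN (\<^bold>v 0 \<^bold>\<in> 0))"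

text \<open>In \<open>comprehension \<phi>\<close> the number variable 0 of \<open>\<phi>\<close> is the comprehended variable; \<open>liftS\<close>
  ensures that the set asserted to exist is not free in \<open>\<phi>\<close>.\<close>

definition comprehension :: "fm \<Rightarrow> fm" where
  "comprehension \<phi> = ExS (AllN (\<^bold>v 0 \<^bold>\<in> 0 \<^bold>\<longleftrightarrow> liftS \<phi>))"

definition Pi11_CA0 :: "fm set" where
  "Pi11_CA0 = basic_axioms \<union> {induction_axiom} \<union> {comprehension \<phi> | \<phi>. Pi11 \<phi>}"


section \<open>Nondeterministic closure extension\<close>

text \<open>
  In the formulas below, \<open>nat\<close> arguments are set variables and \<open>tm\<close> arguments are number terms
  of the surrounding context.
\<close>

definition empty_set :: "nat \<Rightarrow> fm" where
  "empty_set X = AllN (\<^bold>\<not> (\<^bold>v 0 \<^bold>\<in> X))"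

definition subset_set :: "nat \<Rightarrow> nat \<Rightarrow> fm" where
  "subset_set X Y = AllN (\<^bold>v 0 \<^bold>\<in> X \<^bold>\<longrightarrow> \<^bold>v 0 \<^bold>\<in> Y)"

definition finite_set :: "nat \<Rightarrow> fm" where
  "finite_set X = ExN (AllN (\<^bold>v 0 \<^bold>\<in> X \<^bold>\<longrightarrow> \<^bold>v 0 \<^bold>< \<^bold>v 1))"

definition pair :: "tm \<Rightarrow> tm \<Rightarrow> tm" where
  "pair s t = (s \<^bold>+ t) \<^bold>* (s \<^bold>+ t) \<^bold>+ s"

text \<open>\<open>X\<close> is a total function, given as a set of pairs.\<close>

definition function_set :: "nat \<Rightarrow> fm" where
  "function_set X =
    (AllN (\<^bold>v 0 \<^bold>\<in> X \<^bold>\<longrightarrow> ExN (ExN (\<^bold>v 2 \<^bold>= pair (\<^bold>v 1) (\<^bold>v 0)))) \<^bold>\<and>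
     AllN (ExN (AllN (pair (\<^bold>v 2) (\<^bold>v 0) \<^bold>\<in> X \<^bold>\<longleftrightarrow> \<^bold>v 0 \<^bold>= \<^bold>v 1))))"

text \<open>\<open>beta c d j r\<close>: \<open>r\<close> is the remainder of \<open>c\<close> modulo \<open>(j + 1) d + 1\<close> (Goedel's
  \<open>\<beta>\<close>-function).\<close>

definition beta :: "tm \<Rightarrow> tm \<Rightarrow> tm \<Rightarrow> tm \<Rightarrow> fm" where
  "beta c d j r =
    (let m = (j \<^bold>+ \<^bold>1) \<^bold>* d \<^bold>+ \<^bold>1
     in r \<^bold>< m \<^bold>\<and> ExN (lift_tm 1 c \<^bold>= \<^bold>v 0 \<^bold>* lift_tm 1 m \<^bold>+ lift_tm 1 r))"

text \<open>\<open>power_two x p\<close>: \<open>p = 2 ^ x\<close>, i.e. some sequence coded by \<open>c, d\<close> starts with 1, doubles in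
  each of the first \<open>x\<close> steps and has \<open>x\<close>-th entry \<open>p\<close>. In the innermost scope the indices
  3, 2, 1, 0 are \<open>c\<close>, \<open>d\<close>, the step \<open>j\<close> and the \<open>j\<close>-th entry.\<close>

definition power_two :: "tm \<Rightarrow> tm \<Rightarrow> fm" where
  "power_two x p =
    ExN (ExN (
      beta (\<^bold>v 1) (\<^bold>v 0) \<^bold>0 \<^bold>1 \<^bold>\<and>
      AllN (\<^bold>v 0 \<^bold>< lift_tm 3 x \<^bold>\<longrightarrow>
        ExN (beta (\<^bold>v 3) (\<^bold>v 2) (\<^bold>v 1) (\<^bold>v 0) \<^bold>\<and>
             beta (\<^bold>v 3) (\<^bold>v 2) (\<^bold>v 1 \<^bold>+ \<^bold>1) (\<^bold>v 0 \<^bold>+ \<^bold>v 0))) \<^bold>\<and>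
      beta (\<^bold>v 1) (\<^bold>v 0) (lift_tm 2 x) (lift_tm 2 p)))"

text \<open>\<open>canon_mem x e\<close>: \<open>x\<close> belongs to the finite set with canonical index \<open>e\<close>, where the finite
  set \<open>D\<close> has canonical index \<open>\<Sum>x\<in>D. 2 ^ x\<close>. Equivalently, \<open>e = a (2 p) + (p + b)\<close> for
  \<open>p = 2 ^ x\<close> and some \<open>a\<close> and \<open>b < p\<close>; the indices 2, 1, 0 are \<open>p\<close>, \<open>a\<close>, \<open>b\<close>.\<close>

definition canon_mem :: "tm \<Rightarrow> tm \<Rightarrow> fm" where
  "canon_mem x e =
    ExN (ExN (ExN (
      power_two (lift_tm 3 x) (\<^bold>v 2) \<^bold>\<and>
      \<^bold>v 0 \<^bold>< \<^bold>v 2 \<^bold>\<and>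
      lift_tm 3 e \<^bold>= \<^bold>v 1 \<^bold>* (\<^bold>v 2 \<^bold>+ \<^bold>v 2) \<^bold>+ (\<^bold>v 2 \<^bold>+ \<^bold>v 0))))"

text \<open>
  A nondeterministic finitary closure operator \<open>\<langle>\<langle>F\<^sub>i, S\<^sub>i\<rangle> : i \<in> \<nat>\<rangle>\<close> is represented by two sets: the
  function \<open>F\<close> taking \<open>i\<close> to the canonical index of \<open>F\<^sub>i\<close>, and the set \<open>S\<close> coding the sequence
  of sets \<open>S\<^sub>i = {n. (n, i) \<in> S}\<close>.
\<close>

definition closure_operator :: "nat \<Rightarrow> nat \<Rightarrow> fm" where
  "closure_operator F S =
    (function_set F \<^bold>\<and> AllN (ExN (pair (\<^bold>v 0) (\<^bold>v 1) \<^bold>\<in> S)))"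

text \<open>For all \<open>i\<close> and \<open>e\<close> with \<open>F(i) = e\<close>: if the finite set with index \<open>e\<close> is included
  in \<open>X\<close>, then \<open>X\<close> meets \<open>S\<^sub>i\<close>.\<close>

definition closed_set :: "nat \<Rightarrow> nat \<Rightarrow> nat \<Rightarrow> fm" where
  "closed_set F S X =
    AllN (AllN (pair (\<^bold>v 1) (\<^bold>v 0) \<^bold>\<in> F \<^bold>\<longrightarrow>
      AllN (canon_mem (\<^bold>v 0) (\<^bold>v 1) \<^bold>\<longrightarrow> \<^bold>v 0 \<^bold>\<in> X) \<^bold>\<longrightarrow>
      ExN (\<^bold>v 0 \<^bold>\<in> X \<^bold>\<and> pair (\<^bold>v 0) (\<^bold>v 2) \<^bold>\<in> S)))"

text \<open>
  Below, set variable 0 of \<open>\<phi>\<close> is the distinguished variable of \<open>\<phi>(X)\<close>; all other free variables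
  are parameters. \<open>fm_at \<phi> k X\<close> is \<open>\<phi>(X)\<close> written inside \<open>k\<close> set quantifiers: parameters are
  shifted past them.
\<close>

definition fm_at :: "fm \<Rightarrow> nat \<Rightarrow> nat \<Rightarrow> fm" where
  "fm_at \<phi> k X = subst \<^bold>v (case_nat X (\<lambda>i. i + k)) \<phi>"

definition finite_character :: "fm \<Rightarrow> fm" where
  "finite_character \<phi> =
    (AllS (empty_set 0 \<^bold>\<longrightarrow> fm_at \<phi> 1 0) \<^bold>\<and>
     AllS (fm_at \<phi> 1 0 \<^bold>\<longleftrightarrow> AllS (finite_set 0 \<^bold>\<and> subset_set 0 1 \<^bold>\<longrightarrow> fm_at \<phi> 2 0)))"

text \<open>\<open>X\<close> is a closed subset of \<open>A\<close> satisfying \<open>\<phi>\<close>.\<close>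

definition solution :: "fm \<Rightarrow> nat \<Rightarrow> nat \<Rightarrow> nat \<Rightarrow> nat \<Rightarrow> nat \<Rightarrow> fm" where
  "solution \<phi> k F S A X = (closed_set F S X \<^bold>\<and> subset_set X A \<^bold>\<and> fm_at \<phi> k X)"

text \<open>
  The quantified sets are, in order, \<open>F\<close>, \<open>S\<close> (the operator), \<open>A\<close>, the given solution \<open>B\<close>, the
  maximal solution \<open>C\<close> and its competitor \<open>D\<close>; in the innermost scope they have the indices
  5, 4, 3, 2, 1, 0.
\<close>

definition NCE :: "fm \<Rightarrow> fm" where
  "NCE \<phi> =
    (finite_character \<phi> \<^bold>\<longrightarrow>
      AllS (AllS (AllS (closure_operator 2 1 \<^bold>\<longrightarrow>
        AllS (solution \<phi> 4 3 2 1 0 \<^bold>\<longrightarrow>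
          ExS (subset_set 1 0 \<^bold>\<and> solution \<phi> 5 4 3 2 0 \<^bold>\<and>
            AllS (solution \<phi> 6 5 4 3 0 \<^bold>\<and> subset_set 1 0 \<^bold>\<longrightarrow> subset_set 0 1)))))))"

definition Sigma11_NCE :: "fm set" where
  "Sigma11_NCE = {NCE \<phi> | \<phi>. Sigma11 \<phi>}"

end

theory Submission
  imports Defs "HOL-Library.Countable_Set"
begin

text \<open>
  By Henkin's completeness theorem it suffices to work in a countable, possibly nonstandard model.
  Given a solution \<open>B\<close>, call a finite set extendible if it is included in a solution that includes
  \<open>B\<close>. Extendibility is \<open>\<Sigma>\<^sup>1\<^sub>1\<close>, so the set of codes of extendible finite sets exists. Build a
  growing sequence of extendible sets: at stage \<open>s\<close> add the number \<open>s\<close> if the result stays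
  extendible, and if the premise \<open>F\<^sub>i\<close> of the requirement attended to at this stage is
  included in the current set, add an element of \<open>S\<^sub>i\<close>; the latter is possible because the set
  is included in a closed set. Adding a witness promptly is essential, since otherwise the search
  for it could be postponed forever. The union is closed because every \<open>F\<^sub>i\<close> is bounded,
  satisfies the formula by finite character, and is maximal because every \<open>d\<close> was considered.
\<close>

section \<open>Substitution and derivations\<close>

text \<open>The model may be nonstandard, so induction and recursion are available in it only for
  sets that it contains, and "finite" means bounded in its own order. This is the obstacle: the
  growing sequence must itself be a set of the model. Hence finite sets are handled through number
  codes, the next code is the least admissible one, and the graph of the sequence is a fixed point
  of a monotone arithmetical operator, which \<Pi>11 comprehension supplies as an intersection of
  closed sets. The solution \<open>B\<close> may be unbounded and cannot be part of a code; this is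
  why it stands in the definition of extendibility instead, and its elements reach the union because
  every extension contains them. Countability of the model serves definability: all its numbers and
  sets can be named by variables at once, so parameters cost nothing.\<close>

instance tm :: countable by countable_datatype
instance fm :: countable by countable_datatype

lemma subst_tm_subst_tm: "subst_tm \<sigma> (subst_tm \<tau> t) = subst_tm (\<lambda>i. subst_tm \<sigma> (\<tau> i)) t"
  by (induction t) auto

lemma subst_tm_Var [simp]: "subst_tm Var t = t"
  by (induction t) auto

lemma case_nat_Var [simp]: "case_nat (\<^bold>v 0) (\<lambda>i. \<^bold>v (Suc i)) = Var"
  by (auto simp: fun_eq_iff split: nat.split)

lemma case_nat_0_Suc [simp]: "case_nat 0 Suc = id" "case_nat 0 (\<lambda>i. Suc i) = id"
  by (auto simp: fun_eq_iff split: nat.split)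

lemma subst_subst:
  "subst \<sigma> \<rho> (subst \<tau> \<pi> \<phi>) = subst (\<lambda>i. subst_tm \<sigma> (\<tau> i)) (\<lambda>i. \<rho> (\<pi> i)) \<phi>"
proof (induction \<phi> arbitrary: \<sigma> \<rho> \<tau> \<pi>)
  case (AllN \<phi>)
  have "(\<lambda>i. subst_tm (case_nat (\<^bold>v 0) (\<lambda>i. lift_tm 1 (\<sigma> i))) (case i of 0 \<Rightarrow> \<^bold>v 0 | Suc i \<Rightarrow> lift_tm 1 (\<tau> i)))
     = case_nat (\<^bold>v 0) (\<lambda>i. lift_tm 1 (subst_tm \<sigma> (\<tau> i)))"
    by (auto simp: fun_eq_iff lift_tm_def subst_tm_subst_tm split: nat.split)
  then show ?case by (simp add: AllN del: One_nat_def)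
next
  case (AllS \<phi>)
  have "(\<lambda>i. case_nat 0 (\<lambda>i. Suc (\<rho> i)) (case_nat 0 (\<lambda>i. Suc (\<pi> i)) i)) = case_nat 0 (\<lambda>i. Suc (\<rho> (\<pi> i)))"
    by (auto simp: fun_eq_iff split: nat.split)
  then show ?case by (simp add: AllS)
qed (auto simp: subst_tm_subst_tm)

lemma subst_Var_id [simp]: "subst Var id \<phi> = \<phi>"
proof -
  have "\<rho> = id \<Longrightarrow> subst Var \<rho> \<phi> = \<phi>" for \<rho>
    by (induction \<phi> arbitrary: \<rho>) (auto simp: lift_tm_def)
  then show ?thesis by simp
qed

lemma arithmetical_subst: "arithmetical \<phi> \<Longrightarrow> arithmetical (subst \<sigma> \<rho> \<phi>)"
  by (induction \<phi> arbitrary: \<sigma> \<rho>) auto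

lemma subst_liftN:
  "subst (case_nat (\<^bold>v 0) (\<lambda>i. lift_tm 1 (\<sigma> i))) \<rho> (liftN \<phi>) = liftN (subst \<sigma> \<rho> \<phi>)"
  by (simp add: liftN_def subst_subst lift_tm_def)

lemma subst_liftS:
  "subst \<sigma> (case_nat 0 (\<lambda>i. Suc (\<rho> i))) (liftS \<phi>) = liftS (subst \<sigma> \<rho> \<phi>)"
  by (simp add: liftS_def subst_subst)

lemma subst_eq_instN:
  "instN t (subst (case_nat (\<^bold>v 0) (\<lambda>i. lift_tm 1 (\<sigma> i))) \<rho> \<phi>) = subst (case_nat t \<sigma>) \<rho> \<phi>"
  unfolding instN_def subst_subst
  by (rule arg_cong2[where f="\<lambda>x y. subst x y \<phi>"])
    (auto simp: fun_eq_iff lift_tm_def subst_tm_subst_tm split: nat.split)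

lemma subst_eq_instS:
  "instS X (subst \<sigma> (case_nat 0 (\<lambda>i. Suc (\<rho> i))) \<phi>) = subst \<sigma> (case_nat X \<rho>) \<phi>"
  unfolding instS_def subst_subst
  by (rule arg_cong2[where f="\<lambda>x y. subst x y \<phi>"])
    (auto simp: fun_eq_iff split: nat.split)

text \<open>This commutation carries the rules \<open>allNE\<close> and \<open>eqE\<close> through a
  substitution.\<close>

lemma subst_instN:
  "subst \<sigma> \<rho> (instN t \<phi>) = instN (subst_tm \<sigma> t) (subst (case_nat (\<^bold>v 0) (\<lambda>i. lift_tm 1 (\<sigma> i))) \<rho> \<phi>)"
  unfolding subst_eq_instN unfolding instN_def subst_subst
  by (rule arg_cong2[where f="\<lambda>x y. subst x y \<phi>"])
    (auto simp: fun_eq_iff split: nat.split)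

lemma subst_instS:
  "subst \<sigma> \<rho> (instS X \<phi>) = instS (\<rho> X) (subst \<sigma> (case_nat 0 (\<lambda>i. Suc (\<rho> i))) \<phi>)"
  unfolding subst_eq_instS unfolding instS_def subst_subst
  by (rule arg_cong2[where f="\<lambda>x y. subst x y \<phi>"])
    (auto simp: fun_eq_iff split: nat.split)

section \<open>Weakening and finiteness of derivations\<close>

lemma deriv_mono: "deriv T \<Gamma> \<phi> \<Longrightarrow> \<Gamma> \<subseteq> \<Delta> \<Longrightarrow> deriv T \<Delta> \<phi>"
proof (induction arbitrary: \<Delta> rule: deriv.induct)
  case (impI \<phi> \<Gamma> \<psi>)
  then show ?case by (meson deriv.impI insert_mono)
next
  case (raa \<phi> \<Gamma>)
  then show ?case by (meson deriv.raa insert_mono)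
next
  case (allNI \<Gamma> \<phi>)
  then show ?case by (meson deriv.allNI image_mono)
next
  case (allSI \<Gamma> \<phi>)
  then show ?case by (meson deriv.allSI image_mono)
qed (blast intro: deriv.intros)+

lemma deriv_finite: "deriv T \<Gamma> \<phi> \<Longrightarrow> \<exists>\<Gamma>0. finite \<Gamma>0 \<and> \<Gamma>0 \<subseteq> \<Gamma> \<and> deriv T \<Gamma>0 \<phi>"
proof (induction rule: deriv.induct)
  case (axm \<phi> \<Gamma>)
  then show ?case by (meson deriv.axm empty_subsetI finite.emptyI)
next
  case (hyp \<phi> \<Gamma>)
  then show ?case by (intro exI[of _ "{\<phi>}"]) (auto intro: deriv.hyp)
next
  case (impI \<phi> \<Gamma> \<psi>)
  then obtain G where "finite G" "G \<subseteq> insert \<phi> \<Gamma>" "deriv T G \<psi>" by blast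
  then show ?case
    by (intro exI[of _ "G - {\<phi>}"]) (auto intro!: deriv.impI elim!: deriv_mono)
next
  case (impE \<Gamma> \<phi> \<psi>)
  then obtain G G' where "finite G" "G \<subseteq> \<Gamma>" "deriv T G (\<phi> \<^bold>\<longrightarrow> \<psi>)" "finite G'" "G' \<subseteq> \<Gamma>" "deriv T G' \<phi>"
    by blast
  then show ?case
    by (intro exI[of _ "G \<union> G'"]) (auto intro!: deriv.impE[of T _ \<phi> \<psi>] elim!: deriv_mono)
next
  case (raa \<phi> \<Gamma>)
  then obtain G where "finite G" "G \<subseteq> insert (\<^bold>\<not> \<phi>) \<Gamma>" "deriv T G \<^bold>\<bottom>" by blast
  then show ?case
    by (intro exI[of _ "G - {\<^bold>\<not> \<phi>}"]) (auto intro!: deriv.raa elim!: deriv_mono)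
next
  case (allNI \<Gamma> \<phi>)
  \<comment> \<open>A finite subset of the lifted hypotheses is the lift of a finite set of
    hypotheses.\<close>
  then show ?case by (metis deriv.allNI finite_subset_image)
next
  case (allNE \<Gamma> \<phi> t)
  then show ?case by (meson deriv.allNE)
next
  case (allSI \<Gamma> \<phi>)
  then show ?case by (metis deriv.allSI finite_subset_image)
next
  case (allSE \<Gamma> \<phi> X)
  then show ?case by (meson deriv.allSE)
next
  case (eqI \<Gamma> t)
  then show ?case by (meson deriv.eqI empty_subsetI finite.emptyI)
next
  case (eqE \<Gamma> s t \<phi>)
  then obtain G G' where "finite G" "G \<subseteq> \<Gamma>" "deriv T G (s \<^bold>= t)" "finite G'" "G' \<subseteq> \<Gamma>" "deriv T G' (instN s \<phi>)"
    by blast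
  then show ?case
    by (intro exI[of _ "G \<union> G'"]) (auto intro!: deriv.eqE[of T _ s t] elim!: deriv_mono)
qed

section \<open>Fresh variables and generalization\<close>

primrec tm_bound :: "tm \<Rightarrow> nat" where
  "tm_bound (\<^bold>v i) = Suc i"
| "tm_bound \<^bold>0 = 0"
| "tm_bound \<^bold>1 = 0"
| "tm_bound (s \<^bold>+ t) = max (tm_bound s) (tm_bound t)"
| "tm_bound (s \<^bold>* t) = max (tm_bound s) (tm_bound t)"

text \<open>A strict upper bound on the indices of all variables of both sorts. Ignoring the shift at
  binders only makes it larger.\<close>

primrec fm_bound :: "fm \<Rightarrow> nat" where
  "fm_bound \<^bold>\<bottom> = 0"
| "fm_bound (s \<^bold>= t) = max (tm_bound s) (tm_bound t)"
| "fm_bound (s \<^bold>< t) = max (tm_bound s) (tm_bound t)"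
| "fm_bound (t \<^bold>\<in> X) = max (tm_bound t) (Suc X)"
| "fm_bound (\<phi> \<^bold>\<longrightarrow> \<psi>) = max (fm_bound \<phi>) (fm_bound \<psi>)"
| "fm_bound (AllN \<phi>) = fm_bound \<phi>"
| "fm_bound (AllS \<phi>) = fm_bound \<phi>"

lemma subst_tm_cong_bound: "(\<And>i. i < tm_bound t \<Longrightarrow> \<sigma> i = \<tau> i) \<Longrightarrow> subst_tm \<sigma> t = subst_tm \<tau> t"
  by (induction t) auto

lemma subst_cong_bound:
  "(\<And>i. i < fm_bound \<phi> \<Longrightarrow> \<sigma> i = \<tau> i) \<Longrightarrow> (\<And>i. i < fm_bound \<phi> \<Longrightarrow> \<rho> i = \<pi> i) \<Longrightarrow>
    subst \<sigma> \<rho> \<phi> = subst \<tau> \<pi> \<phi>"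
proof (induction \<phi> arbitrary: \<sigma> \<tau> \<rho> \<pi>)
  case (AllN \<phi>)
  show ?case unfolding subst.simps
    by (rule arg_cong[OF AllN.IH]) (use AllN.prems in \<open>auto split: nat.split\<close>)
next
  case (AllS \<phi>)
  show ?case unfolding subst.simps
    by (rule arg_cong[OF AllS.IH]) (use AllS.prems in \<open>auto split: nat.split\<close>)
next
  case (Imp \<phi> \<psi>)
  have "subst \<sigma> \<rho> \<phi> = subst \<tau> \<pi> \<phi>" by (rule Imp.IH) (use Imp.prems in auto)
  moreover have "subst \<sigma> \<rho> \<psi> = subst \<tau> \<pi> \<psi>" by (rule Imp.IH) (use Imp.prems in auto)
  ultimately show ?case by simp
qed (auto intro!: subst_tm_cong_bound)

text \<open>The rule \<open>axm\<close> yields an axiom only with its own free variables. Instances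
  are required to be derivable, not to be axioms, which fits the basic axioms: their instances arise
  by generalization and instantiation.\<close>

locale subst_closed_theory =
  fixes T :: "fm set"
  assumes subst_axm: "\<phi> \<in> T \<Longrightarrow> deriv T {} (subst \<sigma> \<rho> \<phi>)"
begin

lemma deriv_subst: "deriv T \<Gamma> \<phi> \<Longrightarrow> deriv T (subst \<sigma> \<rho> ` \<Gamma>) (subst \<sigma> \<rho> \<phi>)"
proof (induction arbitrary: \<sigma> \<rho> rule: deriv.induct)
  case (axm \<phi> \<Gamma>)
  then show ?case by (meson deriv_mono empty_subsetI subst_axm)
next
  case (hyp \<phi> \<Gamma>)
  then show ?case by (simp add: deriv.hyp)
next
  case (impI \<phi> \<Gamma> \<psi>)
  then show ?case by (auto intro: deriv.impI)
next
  case (impE \<Gamma> \<phi> \<psi>)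
  then show ?case by (metis deriv.impE subst.simps(5))
next
  case (raa \<phi> \<Gamma>)
  show ?case using raa.IH[of \<sigma> \<rho>] by (auto intro: deriv.raa)
next
  case (allNI \<Gamma> \<phi>)
  show ?case using allNI.IH[of "case_nat (\<^bold>v 0) (\<lambda>i. lift_tm 1 (\<sigma> i))" \<rho>]
    by (simp add: image_image subst_liftN deriv.allNI del: One_nat_def)
next
  case (allNE \<Gamma> \<phi> t)
  then show ?case by (auto simp: subst_instN intro: deriv.allNE)
next
  case (allSI \<Gamma> \<phi>)
  show ?case using allSI.IH[of \<sigma> "case_nat 0 (\<lambda>i. Suc (\<rho> i))"]
    by (simp add: image_image subst_liftS deriv.allSI)
next
  case (allSE \<Gamma> \<phi> X)
  then show ?case by (auto simp: subst_instS intro: deriv.allSE)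
next
  case (eqI \<Gamma> t)
  then show ?case by (simp add: deriv.eqI)
next
  case (eqE \<Gamma> s t \<phi>)
  then show ?case by (simp add: subst_instN) (meson deriv.eqE)
qed

text \<open>The rule \<open>allNI\<close> wants lifted hypotheses. Substituting variable 0 for the
  fresh \<open>n\<close> and shifting all other variables turns the instance back into
  \<open>\<phi>\<close> and \<open>\<Gamma>\<close> into its lift.\<close>

lemma deriv_generalizeN:
  assumes "deriv T \<Gamma> (instN (\<^bold>v n) \<phi>)" "\<And>\<gamma>. \<gamma> \<in> insert \<phi> \<Gamma> \<Longrightarrow> fm_bound \<gamma> \<le> n"
  shows "deriv T \<Gamma> (AllN \<phi>)"
proof (rule deriv.allNI)
  let ?\<sigma> = "\<lambda>i. if i = n then \<^bold>v 0 else \<^bold>v (Suc i)"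
  have "deriv T (subst ?\<sigma> id ` \<Gamma>) (subst ?\<sigma> id (instN (\<^bold>v n) \<phi>))"
    by (rule deriv_subst) fact
  moreover have "subst ?\<sigma> id (instN (\<^bold>v n) \<phi>) = subst Var id \<phi>"
    unfolding instN_def subst_subst using assms(2)[of \<phi>]
    by (intro subst_cong_bound) (auto split: nat.split)
  moreover have "subst ?\<sigma> id ` \<Gamma> = liftN ` \<Gamma>"
    unfolding liftN_def
    by (intro image_cong refl subst_cong_bound) (use assms(2) in force)+
  ultimately show "deriv T (liftN ` \<Gamma>) \<phi>" by simp
qed

lemma deriv_generalizeS:
  assumes "deriv T \<Gamma> (instS n \<phi>)" "\<And>\<gamma>. \<gamma> \<in> insert \<phi> \<Gamma> \<Longrightarrow> fm_bound \<gamma> \<le> n"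
  shows "deriv T \<Gamma> (AllS \<phi>)"
proof (rule deriv.allSI)
  let ?\<rho> = "\<lambda>i. if i = n then 0 else Suc i"
  have "deriv T (subst Var ?\<rho> ` \<Gamma>) (subst Var ?\<rho> (instS n \<phi>))"
    by (rule deriv_subst) fact
  moreover have "subst Var ?\<rho> (instS n \<phi>) = subst Var id \<phi>"
    unfolding instS_def subst_subst using assms(2)[of \<phi>]
    by (intro subst_cong_bound) (auto split: nat.split)
  moreover have "subst Var ?\<rho> ` \<Gamma> = liftS ` \<Gamma>"
    unfolding liftS_def
    by (intro image_cong refl subst_cong_bound) (use assms(2) in force)+
  ultimately show "deriv T (liftS ` \<Gamma>) \<phi>" by simp
qed

section \<open>Henkin sets\<close>

definition consistent :: "fm set \<Rightarrow> bool" where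
  "consistent \<Gamma> \<longleftrightarrow> \<not> deriv T \<Gamma> \<^bold>\<bottom>"

definition fresh :: "fm set \<Rightarrow> nat" where
  "fresh \<Gamma> = Max (fm_bound ` \<Gamma>)"

text \<open>Free variables serve as Henkin constants: every stage of the construction is a finite
  set, so an index above all variables in use exists and the language stays as it is.\<close>

definition henkin_witness :: "fm set \<Rightarrow> fm \<Rightarrow> fm set" where
  "henkin_witness \<Gamma> \<phi> = (case \<phi> of
      AllN \<chi> \<Rightarrow> {\<^bold>\<not> (instN (\<^bold>v (fresh (insert \<phi> \<Gamma>))) \<chi>)}
    | AllS \<chi> \<Rightarrow> {\<^bold>\<not> (instS (fresh (insert \<phi> \<Gamma>)) \<chi>)}
    | _ \<Rightarrow> {})"

definition extend :: "fm set \<Rightarrow> fm \<Rightarrow> fm set" where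
  "extend \<Gamma> \<phi> = (if consistent (insert \<phi> \<Gamma>) then insert \<phi> \<Gamma>
     else insert (\<^bold>\<not> \<phi>) \<Gamma> \<union> henkin_witness \<Gamma> \<phi>)"

lemma finite_extend: "finite \<Gamma> \<Longrightarrow> finite (extend \<Gamma> \<phi>)"
  by (auto simp: extend_def henkin_witness_def split: fm.split)

lemma fresh_bound: "finite \<Gamma> \<Longrightarrow> \<gamma> \<in> \<Gamma> \<Longrightarrow> fm_bound \<gamma> \<le> fresh \<Gamma>"
  by (simp add: fresh_def)

lemma consistent_extend:
  assumes "finite \<Gamma>" "consistent \<Gamma>"
  shows "consistent (extend \<Gamma> \<phi>)"
proof (cases "consistent (insert \<phi> \<Gamma>)")
  case False
  have con: "consistent (insert (\<^bold>\<not> \<phi>) \<Gamma>)"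
    using False assms(2) unfolding consistent_def by (meson deriv.impE deriv.impI)
  \<comment> \<open>If adding the negated instance were inconsistent, the instance would be
    derivable, hence, by generalizing the fresh variable, so would \<open>\<phi>\<close>, whose
    negation is already present.\<close>
  have *: "consistent (insert (\<^bold>\<not> \<psi>) (insert (\<^bold>\<not> \<phi>) \<Gamma>))"
    if "deriv T (insert (\<^bold>\<not> \<phi>) \<Gamma>) \<psi> \<Longrightarrow> deriv T (insert (\<^bold>\<not> \<phi>) \<Gamma>) \<phi>" for \<psi>
    using that con unfolding consistent_def
    by (meson deriv.impE deriv.hyp deriv.raa insertI1)
  show ?thesis
  proof (cases \<phi>)
    case (AllN \<chi>)
    have "consistent (insert (\<^bold>\<not> instN (\<^bold>v (fresh (insert \<phi> \<Gamma>))) \<chi>) (insert (\<^bold>\<not> \<phi>) \<Gamma>))"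
    proof (rule *, unfold AllN, rule deriv_generalizeN)
      fix \<gamma> assume "\<gamma> \<in> insert \<chi> (insert (\<^bold>\<not> AllN \<chi>) \<Gamma>)"
      then show "fm_bound \<gamma> \<le> fresh (insert (AllN \<chi>) \<Gamma>)"
        using fresh_bound[of "insert (AllN \<chi>) \<Gamma>"] assms by fastforce
    qed
    then show ?thesis using False AllN by (simp add: extend_def henkin_witness_def)
  next
    case (AllS \<chi>)
    have "consistent (insert (\<^bold>\<not> instS (fresh (insert \<phi> \<Gamma>)) \<chi>) (insert (\<^bold>\<not> \<phi>) \<Gamma>))"
    proof (rule *, unfold AllS, rule deriv_generalizeS)
      fix \<gamma> assume "\<gamma> \<in> insert \<chi> (insert (\<^bold>\<not> AllS \<chi>) \<Gamma>)"
      then show "fm_bound \<gamma> \<le> fresh (insert (AllS \<chi>) \<Gamma>)"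
        using fresh_bound[of "insert (AllS \<chi>) \<Gamma>"] assms by fastforce
    qed
    then show ?thesis using False AllS by (simp add: extend_def henkin_witness_def)
  qed (use False con in \<open>auto simp: extend_def henkin_witness_def\<close>)
qed (simp add: extend_def)

primrec henkin_chain :: "fm set \<Rightarrow> nat \<Rightarrow> fm set" where
  "henkin_chain \<Gamma> 0 = \<Gamma>"
| "henkin_chain \<Gamma> (Suc n) = extend (henkin_chain \<Gamma> n) (from_nat n)"

lemma finite_henkin_chain: "finite \<Gamma> \<Longrightarrow> finite (henkin_chain \<Gamma> n)"
  by (induction n) (auto intro: finite_extend)

lemma consistent_henkin_chain: "finite \<Gamma> \<Longrightarrow> consistent \<Gamma> \<Longrightarrow> consistent (henkin_chain \<Gamma> n)"
  by (induction n) (auto intro: consistent_extend finite_henkin_chain)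

lemma mono_henkin_chain: "m \<le> n \<Longrightarrow> henkin_chain \<Gamma> m \<subseteq> henkin_chain \<Gamma> n"
  by (rule lift_Suc_mono_le[of "henkin_chain \<Gamma>"]) (auto simp: extend_def)

definition henkin_set :: "fm set \<Rightarrow> bool" where
  "henkin_set H \<longleftrightarrow> consistent H \<and> (\<forall>\<phi>. \<phi> \<in> H \<or> (\<^bold>\<not> \<phi>) \<in> H) \<and>
     (\<forall>\<chi>. AllN \<chi> \<in> H \<or> (\<exists>t. (\<^bold>\<not> instN t \<chi>) \<in> H)) \<and>
     (\<forall>\<chi>. AllS \<chi> \<in> H \<or> (\<exists>X. (\<^bold>\<not> instS X \<chi>) \<in> H))"

text \<open>The formula number n of the enumeration is decided in passing from stage n to stage n +
  1. Consistency survives the union because a derivation uses finitely many hypotheses.\<close>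

lemma henkin_set_exists:
  assumes "finite \<Gamma>" "consistent \<Gamma>"
  shows "\<exists>H. \<Gamma> \<subseteq> H \<and> henkin_set H"
proof (intro exI conjI)
  let ?H = "\<Union>n. henkin_chain \<Gamma> n"
  show "\<Gamma> \<subseteq> ?H" using henkin_chain.simps(1)[of \<Gamma>] by blast
  have decided: "\<phi> \<in> ?H \<or> (insert (\<^bold>\<not> \<phi>) (henkin_witness (henkin_chain \<Gamma> (to_nat \<phi>)) \<phi>) \<subseteq> ?H)" for \<phi>
  proof -
    have "henkin_chain \<Gamma> (Suc (to_nat \<phi>)) \<subseteq> ?H" by blast
    then show ?thesis by (auto simp: extend_def split: if_splits)
  qed
  have "consistent ?H"
    unfolding consistent_def
  proof
    assume "deriv T ?H \<^bold>\<bottom>"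
    from deriv_finite[OF this] obtain G where G: "finite G" "G \<subseteq> ?H" "deriv T G \<^bold>\<bottom>"
      by (elim exE conjE)
    have "finite G \<Longrightarrow> G \<subseteq> ?H \<Longrightarrow> \<exists>n. G \<subseteq> henkin_chain \<Gamma> n" for G
    proof (induction G rule: finite_induct)
      case (insert x F)
      then obtain n where "F \<subseteq> henkin_chain \<Gamma> n" by blast
      moreover obtain m where "x \<in> henkin_chain \<Gamma> m" using insert.prems by blast
      ultimately have "insert x F \<subseteq> henkin_chain \<Gamma> (max m n)"
        using mono_henkin_chain[of m "max m n"] mono_henkin_chain[of n "max m n"] by fastforce
      then show ?case by blast
    qed auto
    then have "\<exists>n. G \<subseteq> henkin_chain \<Gamma> n" using G by blast
    then obtain n where "G \<subseteq> henkin_chain \<Gamma> n" ..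
    from deriv_mono[OF G(3) this] consistent_henkin_chain[OF assms] show False
      unfolding consistent_def by simp
  qed
  then show "henkin_set ?H"
    unfolding henkin_set_def
  proof (intro conjI allI)
    show "\<phi> \<in> ?H \<or> (\<^bold>\<not> \<phi>) \<in> ?H" for \<phi>
      using decided[of \<phi>] by blast
    show "AllN \<chi> \<in> ?H \<or> (\<exists>t. (\<^bold>\<not> instN t \<chi>) \<in> ?H)" for \<chi>
      using decided[of "AllN \<chi>"] unfolding henkin_witness_def fm.case by blast
    show "AllS \<chi> \<in> ?H \<or> (\<exists>X. (\<^bold>\<not> instS X \<chi>) \<in> ?H)" for \<chi>
      using decided[of "AllS \<chi>"] unfolding henkin_witness_def fm.case by blast
  qed
qed

end

section \<open>The completeness theorem\<close>

locale second_order_structure =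
  fixes zr on :: 'a and pl ti :: "'a \<Rightarrow> 'a \<Rightarrow> 'a" and ls :: "'a \<Rightarrow> 'a \<Rightarrow> bool" and SS :: "'a set set"
begin

primrec val :: "(nat \<Rightarrow> 'a) \<Rightarrow> tm \<Rightarrow> 'a" where
  "val e (\<^bold>v i) = e i"
| "val e \<^bold>0 = zr"
| "val e \<^bold>1 = on"
| "val e (s \<^bold>+ t) = pl (val e s) (val e t)"
| "val e (s \<^bold>* t) = ti (val e s) (val e t)"

primrec sat :: "(nat \<Rightarrow> 'a) \<Rightarrow> (nat \<Rightarrow> 'a set) \<Rightarrow> fm \<Rightarrow> bool" where
  "sat e E \<^bold>\<bottom> \<longleftrightarrow> False"
| "sat e E (s \<^bold>= t) \<longleftrightarrow> val e s = val e t"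
| "sat e E (s \<^bold>< t) \<longleftrightarrow> ls (val e s) (val e t)"
| "sat e E (t \<^bold>\<in> X) \<longleftrightarrow> val e t \<in> E X"
| "sat e E (\<phi> \<^bold>\<longrightarrow> \<psi>) \<longleftrightarrow> (sat e E \<phi> \<longrightarrow> sat e E \<psi>)"
| "sat e E (AllN \<phi>) \<longleftrightarrow> (\<forall>x. sat (case_nat x e) E \<phi>)"
| "sat e E (AllS \<phi>) \<longleftrightarrow> (\<forall>X\<in>SS. sat e (case_nat X E) \<phi>)"

lemma val_subst_tm: "val e (subst_tm \<sigma> t) = val (\<lambda>i. val e (\<sigma> i)) t"
  by (induction t) auto

lemma val_lift_tm [simp]: "val e (lift_tm k t) = val (\<lambda>i. e (i + k)) t"
  by (simp add: lift_tm_def val_subst_tm)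

lemma sat_subst: "sat e E (subst \<sigma> \<rho> \<phi>) \<longleftrightarrow> sat (\<lambda>i. val e (\<sigma> i)) (\<lambda>i. E (\<rho> i)) \<phi>"
proof (induction \<phi> arbitrary: e E \<sigma> \<rho>)
  case (AllN \<phi>)
  have "(\<lambda>i. val (case_nat x e) (case_nat (\<^bold>v 0) (\<lambda>i. lift_tm 1 (\<sigma> i)) i)) = case_nat x (\<lambda>i. val e (\<sigma> i))" for x
    by (auto simp: fun_eq_iff split: nat.split)
  then show ?case by (simp add: AllN del: One_nat_def)
next
  case (AllS \<phi>)
  have "(\<lambda>i. case_nat X E (case_nat 0 (\<lambda>i. Suc (\<rho> i)) i)) = case_nat X (\<lambda>i. E (\<rho> i))" for X
    by (auto simp: fun_eq_iff split: nat.split)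
  then show ?case by (simp add: AllS)
qed (auto simp: val_subst_tm)

lemma sat_liftS [simp]: "sat e E (liftS \<phi>) \<longleftrightarrow> sat e (\<lambda>i. E (Suc i)) \<phi>"
  by (simp add: liftS_def sat_subst)

end

section \<open>The term model of a Henkin set\<close>

locale henkin_model = subst_closed_theory +
  fixes H :: "fm set"
  assumes henkin: "henkin_set H" and basic: "basic_axioms \<subseteq> T"
begin

lemma closed: "deriv T H \<phi> \<Longrightarrow> \<phi> \<in> H"
  using henkin unfolding henkin_set_def consistent_def by (meson deriv.hyp deriv.impE)

lemma consistentH: "\<not> deriv T H \<^bold>\<bottom>"
  using henkin unfolding henkin_set_def consistent_def by blast

lemma Fls_H [simp]: "\<^bold>\<bottom> \<notin> H"
  using consistentH deriv.hyp by blast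

lemma Neg_H: "(\<^bold>\<not> \<phi>) \<in> H \<longleftrightarrow> \<phi> \<notin> H"
  using henkin consistentH unfolding henkin_set_def by (meson deriv.hyp deriv.impE)

lemma Imp_H [simp]: "(\<phi> \<^bold>\<longrightarrow> \<psi>) \<in> H \<longleftrightarrow> (\<phi> \<in> H \<longrightarrow> \<psi> \<in> H)"
proof
  show "\<phi> \<in> H \<longrightarrow> \<psi> \<in> H" if "(\<phi> \<^bold>\<longrightarrow> \<psi>) \<in> H"
    using that closed by (meson deriv.hyp deriv.impE)
  show "(\<phi> \<^bold>\<longrightarrow> \<psi>) \<in> H" if "\<phi> \<in> H \<longrightarrow> \<psi> \<in> H"
  proof (cases "\<phi> \<in> H")
    case True
    then have "deriv T (insert \<phi> H) \<psi>" using that by (simp add: deriv.hyp)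
    then show ?thesis by (rule closed[OF deriv.impI])
  next
    case False
    then have "(\<^bold>\<not> \<phi>) \<in> H" by (simp add: Neg_H)
    then have "deriv T (insert (\<^bold>\<not> \<psi>) (insert \<phi> H)) \<^bold>\<bottom>"
      by (auto intro: deriv.impE[where \<phi>=\<phi>, OF deriv.hyp deriv.hyp])
    then show ?thesis by (rule closed[OF deriv.impI[OF deriv.raa]])
  qed
qed

lemma AllN_H: "AllN \<chi> \<in> H \<longleftrightarrow> (\<forall>t. instN t \<chi> \<in> H)"
  using henkin Neg_H unfolding henkin_set_def by (meson closed deriv.hyp deriv.allNE)

lemma AllS_H: "AllS \<chi> \<in> H \<longleftrightarrow> (\<forall>X. instS X \<chi> \<in> H)"
  using henkin Neg_H unfolding henkin_set_def by (meson closed deriv.hyp deriv.allSE)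

lemma axiom_H: "\<phi> \<in> T \<Longrightarrow> subst \<sigma> \<rho> \<phi> \<in> H"
  by (meson closed deriv_mono empty_subsetI subst_axm)

lemma eq_refl: "(t \<^bold>= t) \<in> H"
  by (intro closed deriv.eqI)

lemma eq_subst: "(s \<^bold>= t) \<in> H \<Longrightarrow> instN s \<phi> \<in> H \<Longrightarrow> instN t \<phi> \<in> H"
  by (meson closed deriv.hyp deriv.eqE)

lemma subst_tm_lift [simp]: "subst_tm (case_nat t Var) (lift_tm (Suc 0) u) = u"
  by (simp add: lift_tm_def subst_tm_subst_tm)

lemma eq_sym: "(s \<^bold>= t) \<in> H \<Longrightarrow> (t \<^bold>= s) \<in> H"
  using eq_subst[of s t "\<^bold>v 0 \<^bold>= lift_tm 1 s"] by (simp add: instN_def eq_refl)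

lemma eq_trans: "(s \<^bold>= t) \<in> H \<Longrightarrow> (t \<^bold>= u) \<in> H \<Longrightarrow> (s \<^bold>= u) \<in> H"
  using eq_subst[of t u "lift_tm 1 s \<^bold>= \<^bold>v 0"] by (simp add: instN_def)

lemma eq_Add: "(s \<^bold>= s') \<in> H \<Longrightarrow> (t \<^bold>= t') \<in> H \<Longrightarrow> (s \<^bold>+ t \<^bold>= s' \<^bold>+ t') \<in> H"
  using eq_subst[of s s' "lift_tm 1 (s \<^bold>+ t) \<^bold>= \<^bold>v 0 \<^bold>+ lift_tm 1 t"]
    eq_subst[of t t' "lift_tm 1 (s \<^bold>+ t) \<^bold>= lift_tm 1 s' \<^bold>+ \<^bold>v 0"]
  by (simp add: instN_def eq_refl)

lemma eq_Mul: "(s \<^bold>= s') \<in> H \<Longrightarrow> (t \<^bold>= t') \<in> H \<Longrightarrow> (s \<^bold>* t \<^bold>= s' \<^bold>* t') \<in> H"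
  using eq_subst[of s s' "lift_tm 1 (s \<^bold>* t) \<^bold>= \<^bold>v 0 \<^bold>* lift_tm 1 t"]
    eq_subst[of t t' "lift_tm 1 (s \<^bold>* t) \<^bold>= lift_tm 1 s' \<^bold>* \<^bold>v 0"]
  by (simp add: instN_def eq_refl)

lemma eq_Less: "(s \<^bold>= s') \<in> H \<Longrightarrow> (t \<^bold>= t') \<in> H \<Longrightarrow> (s \<^bold>< t) \<in> H \<Longrightarrow> (s' \<^bold>< t') \<in> H"
  using eq_subst[of s s' "\<^bold>v 0 \<^bold>< lift_tm 1 t"] eq_subst[of t t' "lift_tm 1 s' \<^bold>< \<^bold>v 0"]
  by (simp add: instN_def)

lemma eq_Mem: "(s \<^bold>= s') \<in> H \<Longrightarrow> (s \<^bold>\<in> X) \<in> H \<Longrightarrow> (s' \<^bold>\<in> X) \<in> H"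
  using eq_subst[of s s' "\<^bold>v 0 \<^bold>\<in> X"] by (simp add: instN_def)

definition eq_class :: "tm \<Rightarrow> tm set" where
  "eq_class t = {s. (s \<^bold>= t) \<in> H}"

lemma eq_class_eq_iff: "eq_class s = eq_class t \<longleftrightarrow> (s \<^bold>= t) \<in> H"
  unfolding eq_class_def using eq_refl eq_sym eq_trans by blast

primrec numeral_tm :: "nat \<Rightarrow> tm" where
  "numeral_tm 0 = \<^bold>0"
| "numeral_tm (Suc n) = numeral_tm n \<^bold>+ \<^bold>1"

text \<open>Guarantees infinitely many classes of terms, so that the model can live on the whole of
  \<open>nat\<close>.\<close>

lemma inj_numeral: "(numeral_tm m \<^bold>= numeral_tm n) \<in> H \<Longrightarrow> m = n"
proof (induction m arbitrary: n)
  have ne: "(t \<^bold>+ \<^bold>1 \<^bold>= \<^bold>0) \<notin> H" for t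
    using axiom_H[of "\<^bold>\<not> (\<^bold>v 0 \<^bold>+ \<^bold>1 \<^bold>= \<^bold>0)" "\<lambda>_. t" id] basic by (auto simp: basic_axioms_def)
  have inj: "(s \<^bold>= t) \<in> H" if "(s \<^bold>+ \<^bold>1 \<^bold>= t \<^bold>+ \<^bold>1) \<in> H" for s t
    using axiom_H[of "\<^bold>v 0 \<^bold>+ \<^bold>1 \<^bold>= \<^bold>v 1 \<^bold>+ \<^bold>1 \<^bold>\<longrightarrow> \<^bold>v 0 \<^bold>= \<^bold>v 1" "case_nat s (\<lambda>_. t)" id] basic that
    by (auto simp: basic_axioms_def)
  {
    case 0
    then show ?case using ne eq_sym by (cases n) auto
  next
    case (Suc m)
    then show ?case using ne inj by (cases n) auto
  }
qed

text \<open>The elements of the model are terms modulo equality in \<open>H\<close>, renumbered by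
  natural numbers; completeness can then quantify over structures on one fixed type.\<close>

definition class_of :: "tm \<Rightarrow> nat" where
  "class_of t = to_nat_on (range eq_class) (eq_class t)"

lemma class_of_eq_iff: "class_of s = class_of t \<longleftrightarrow> (s \<^bold>= t) \<in> H"
  unfolding class_of_def by (subst to_nat_on_inj) (auto simp: eq_class_eq_iff)

lemma surj_class_of: "\<exists>t. class_of t = n"
proof -
  have "inj (\<lambda>n. eq_class (numeral_tm n))"
    by (auto intro!: injI inj_numeral simp: eq_class_eq_iff)
  then have "infinite (range (\<lambda>n. eq_class (numeral_tm n)))"
    by (rule range_inj_infinite)
  then have "infinite (range eq_class)"
    by (rule infinite_super[rotated]) auto
  then have "bij_betw (to_nat_on (range eq_class)) (range eq_class) UNIV"
    by (intro to_nat_on_infinite) auto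
  then show ?thesis unfolding class_of_def bij_betw_def by (metis UNIV_I imageE)
qed

definition rep :: "nat \<Rightarrow> tm" where
  "rep n = (SOME t. class_of t = n)"

lemma class_of_rep [simp]: "class_of (rep n) = n"
  unfolding rep_def by (rule someI_ex) (rule surj_class_of)

lemma rep_class_of: "(rep (class_of t) \<^bold>= t) \<in> H" "(t \<^bold>= rep (class_of t)) \<in> H"
  by (simp_all flip: class_of_eq_iff)

definition add_op :: "nat \<Rightarrow> nat \<Rightarrow> nat" where "add_op m n = class_of (rep m \<^bold>+ rep n)"
definition mul_op :: "nat \<Rightarrow> nat \<Rightarrow> nat" where "mul_op m n = class_of (rep m \<^bold>* rep n)"
definition less_op :: "nat \<Rightarrow> nat \<Rightarrow> bool" where "less_op m n \<longleftrightarrow> (rep m \<^bold>< rep n) \<in> H"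
definition set_of :: "nat \<Rightarrow> nat set" where "set_of X = {n. (rep n \<^bold>\<in> X) \<in> H}"

sublocale second_order_structure "class_of \<^bold>0" "class_of \<^bold>1" add_op mul_op less_op "range set_of" .

lemma add_op_class_of: "add_op (class_of s) (class_of t) = class_of (s \<^bold>+ t)"
  unfolding add_op_def class_of_eq_iff by (intro eq_Add rep_class_of)

lemma mul_op_class_of: "mul_op (class_of s) (class_of t) = class_of (s \<^bold>* t)"
  unfolding mul_op_def class_of_eq_iff by (intro eq_Mul rep_class_of)

lemma less_op_class_of: "less_op (class_of s) (class_of t) \<longleftrightarrow> (s \<^bold>< t) \<in> H"
  unfolding less_op_def using eq_Less rep_class_of by meson

lemma set_of_class_of: "class_of t \<in> set_of X \<longleftrightarrow> (t \<^bold>\<in> X) \<in> H"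
  unfolding set_of_def using eq_Mem rep_class_of by blast

lemma val_class_of: "val (\<lambda>i. class_of (\<sigma> i)) t = class_of (subst_tm \<sigma> t)"
  by (induction t) (auto simp: add_op_class_of mul_op_class_of)

text \<open>Arbitrary substitutions make the induction work: each number is the class of a term and
  each set of the family is named by a set variable, so a quantifier amounts to its instances, as it
  does in a Henkin set.\<close>

lemma truth: "sat (\<lambda>i. class_of (\<sigma> i)) (\<lambda>i. set_of (\<rho> i)) \<phi> \<longleftrightarrow> subst \<sigma> \<rho> \<phi> \<in> H"
proof (induction \<phi> arbitrary: \<sigma> \<rho>)
  case (AllN \<phi>)
  have *: "(\<forall>x. P x) \<longleftrightarrow> (\<forall>t. P (class_of t))" for P using surj_class_of by metis
  have "case_nat (class_of t) (\<lambda>i. class_of (\<sigma> i)) = (\<lambda>i. class_of (case_nat t \<sigma> i))" for t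
    by (auto simp: fun_eq_iff split: nat.split)
  then show ?case by (simp add: * AllN AllN_H subst_eq_instN del: One_nat_def)
next
  case (AllS \<phi>)
  have "case_nat (set_of X) (\<lambda>i. set_of (\<rho> i)) = (\<lambda>i. set_of (case_nat X \<rho> i))" for X
    by (auto simp: fun_eq_iff split: nat.split)
  then show ?case by (simp add: AllS AllS_H subst_eq_instS)
qed (auto simp: val_class_of class_of_eq_iff less_op_class_of set_of_class_of)

lemma sat_axiom: "\<phi> \<in> T \<Longrightarrow> range E \<subseteq> range set_of \<Longrightarrow> sat e E \<phi>"
proof -
  assume "\<phi> \<in> T" and "range E \<subseteq> range set_of"
  then have "\<exists>\<rho>. \<forall>i. E i = set_of (\<rho> i)" by (subst choice_iff[symmetric]) blast
  then obtain \<rho> where "E = (\<lambda>i. set_of (\<rho> i))" by (auto simp: fun_eq_iff)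
  moreover have "e = (\<lambda>i. class_of (rep (e i)))" by simp
  ultimately show ?thesis using truth[of "\<lambda>i. rep (e i)" \<rho> \<phi>] axiom_H[OF \<open>\<phi> \<in> T\<close>] by simp
qed

end

theorem (in subst_closed_theory) completeness:
  assumes "basic_axioms \<subseteq> T"
    and "\<And>(zr :: nat) on pl ti ls SS e E. countable SS \<Longrightarrow>
      (\<And>\<phi> e E. \<phi> \<in> T \<Longrightarrow> range E \<subseteq> SS \<Longrightarrow> second_order_structure.sat zr on pl ti ls SS e E \<phi>) \<Longrightarrow>
      range E \<subseteq> SS \<Longrightarrow> second_order_structure.sat zr on pl ti ls SS e E \<psi>"
  shows "T \<turnstile> \<psi>"
proof (rule ccontr)
  assume "\<not> T \<turnstile> \<psi>"
  then have "consistent {\<^bold>\<not> \<psi>}"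
    unfolding consistent_def provable_def by (meson deriv.raa)
  then obtain H where H: "{\<^bold>\<not> \<psi>} \<subseteq> H" "henkin_set H"
    using henkin_set_exists[of "{\<^bold>\<not> \<psi>}"] by auto
  interpret henkin_model T H by unfold_locales fact+
  \<comment> \<open>In the environment where every variable denotes itself, truth is membership in
    \<open>H\<close>, which contains the negation of \<open>\<psi>\<close>.\<close>
  have "sat (\<lambda>i. class_of (\<^bold>v i)) (\<lambda>i. set_of (id i)) \<psi>"
    by (rule assms(2)) (auto intro!: sat_axiom)
  then have "\<psi> \<in> H" by (simp only: truth subst_Var_id)
  then show False using H(1) Neg_H by blast
qed

text \<open>Meant for the basic axioms, whose only variables are the number variables 0 and 1: both
  are generalized, then instantiated from the outside in.\<close>

lemma deriv_closure_two:
  assumes "\<phi> \<in> T"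
  shows "deriv T {} (subst (case_nat s (case_nat t Var)) id \<phi>)"
proof -
  have "deriv T {} (AllN (AllN \<phi>))"
    by (intro deriv.allNI deriv.axm assms)
  then have "deriv T {} (instN s (subst (case_nat (\<^bold>v 0) (\<lambda>i. lift_tm 1 (case_nat t Var i))) id \<phi>))"
    using deriv.allNE[of T "{}" "AllN \<phi>" t]
    by (intro deriv.allNE) (simp add: instN_def)
  then show ?thesis by (simp only: subst_eq_instN)
qed

interpretation Pi11_CA0: subst_closed_theory Pi11_CA0
proof
  fix \<phi> \<sigma> \<rho>
  assume "\<phi> \<in> Pi11_CA0"
  then consider "\<phi> \<in> basic_axioms" | "\<phi> = induction_axiom" | \<theta> where "\<phi> = comprehension (AllS \<theta>)" "arithmetical \<theta>"
    unfolding Pi11_CA0_def Pi11_def by blast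
  then show "deriv Pi11_CA0 {} (subst \<sigma> \<rho> \<phi>)"
  proof cases
    case 1
    then have "subst \<sigma> \<rho> \<phi> = subst (case_nat (\<sigma> 0) (case_nat (\<sigma> 1) Var)) id \<phi>"
      unfolding basic_axioms_def by auto
    then show ?thesis using deriv_closure_two[OF \<open>\<phi> \<in> Pi11_CA0\<close>] by simp
  next
    case 2
    have "deriv Pi11_CA0 {} (AllS \<phi>)"
      by (intro deriv.allSI deriv.axm \<open>\<phi> \<in> Pi11_CA0\<close>)
    then have "deriv Pi11_CA0 {} (instS (\<rho> 0) \<phi>)" by (rule deriv.allSE)
    then show ?thesis by (simp add: 2 induction_axiom_def instS_def)
  next
    case (3 \<theta>)
    \<comment> \<open>An instance of comprehension is comprehension for the substituted formula,
      which is again \<Pi>11.\<close>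
    have "subst \<sigma> \<rho> (comprehension \<chi>) =
        comprehension (subst (case_nat (\<^bold>v 0) (\<lambda>i. lift_tm 1 (\<sigma> i))) \<rho> \<chi>)" for \<chi>
      by (simp add: comprehension_def subst_liftS del: One_nat_def)
    moreover have "comprehension (subst (case_nat (\<^bold>v 0) (\<lambda>i. lift_tm 1 (\<sigma> i))) \<rho> (AllS \<theta>)) \<in> Pi11_CA0"
      unfolding Pi11_CA0_def Pi11_def using arithmetical_subst[OF 3(2)] by auto
    ultimately show ?thesis by (simp add: 3 deriv.axm del: One_nat_def subst.simps(7))
  qed
qed

section \<open>Arithmetical definability in a model\<close>

locale Pi11_model = second_order_structure zr on pl ti ls SS
  for zr :: "'a :: countable" (\<open>\<zero>\<close>) and on (\<open>\<one>\<close>) and pl (infixl \<open>\<oplus>\<close> 65) and ti (infixl \<open>\<otimes>\<close> 70)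
    and ls (infix \<open>\<prec>\<close> 50) and SS +
  assumes countable_sets: "countable SS"
    and sat_axiom: "\<phi> \<in> Pi11_CA0 \<Longrightarrow> range E \<subseteq> SS \<Longrightarrow> sat e E \<phi>"
    and sets_nonempty: "SS \<noteq> {}"
begin

lemma from_nat_into_sets [simp]: "from_nat_into SS i \<in> SS"
  by (simp add: from_nat_into sets_nonempty)

lemma Pi11_comprehension:
  assumes "arithmetical \<theta>" "range E \<subseteq> SS"
  shows "{x. \<forall>X\<in>SS. sat (case_nat x e) (case_nat X E) \<theta>} \<in> SS"
proof -
  have "comprehension (AllS \<theta>) \<in> Pi11_CA0"
    unfolding Pi11_CA0_def Pi11_def using assms by auto
  define R where "R x \<longleftrightarrow> (\<forall>X\<in>SS. sat (case_nat x e) (case_nat X E) \<theta>)" for x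
  have "\<exists>Y\<in>SS. \<forall>x. x \<in> Y \<longleftrightarrow> R x"
    using sat_axiom[OF \<open>comprehension _ \<in> _\<close> assms(2), of e] unfolding comprehension_def
    by (simp flip: R_def) blast
  then obtain Y where "Y \<in> SS" "\<And>x. x \<in> Y \<longleftrightarrow> R x" by blast
  then have "Y = {x. R x}" by auto
  with \<open>Y \<in> SS\<close> show ?thesis by (simp add: R_def)
qed

text \<open>The variables of even index form the environment; those of odd index, like the set variables
  other than 0, name all elements of the countable model, so every parameter is available.\<close>

definition env :: "(nat \<Rightarrow> 'a) \<Rightarrow> nat \<Rightarrow> 'a" where
  "env e i = (if even i then e (i div 2) else from_nat (i div 2))"

definition term_fun :: "((nat \<Rightarrow> 'a) \<Rightarrow> 'a) \<Rightarrow> bool" where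
  "term_fun f \<longleftrightarrow> (\<exists>t. \<forall>e. f e = val (env e) t)"

text \<open>A semantic form of the arithmetical formulas with parameters. The single set slot
  \<open>Z\<close> is reserved for the one set quantifier that comprehension allows. Closure rules
  for connectives and number quantifiers then replace the writing of formulas.\<close>

definition definable :: "('a set \<Rightarrow> (nat \<Rightarrow> 'a) \<Rightarrow> bool) \<Rightarrow> bool" where
  "definable P \<longleftrightarrow> (\<exists>\<phi>. arithmetical \<phi> \<and>
     (\<forall>Z e. P Z e \<longleftrightarrow> sat (env e) (case_nat Z (from_nat_into SS)) \<phi>))"

named_theorems definable_intros

lemma term_fun_var [definable_intros]: "term_fun (\<lambda>e. e k)"
  unfolding term_fun_def by (intro exI[of _ "\<^bold>v (2 * k)"]) (simp add: env_def)

lemma term_fun_const [definable_intros]: "term_fun (\<lambda>e. c)"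
  unfolding term_fun_def by (intro exI[of _ "\<^bold>v (2 * to_nat c + 1)"]) (simp add: env_def)

lemma term_fun_add [definable_intros]: "term_fun f \<Longrightarrow> term_fun g \<Longrightarrow> term_fun (\<lambda>e. f e \<oplus> g e)"
  unfolding term_fun_def by (metis val.simps(4))

lemma term_fun_mult [definable_intros]: "term_fun f \<Longrightarrow> term_fun g \<Longrightarrow> term_fun (\<lambda>e. f e \<otimes> g e)"
  unfolding term_fun_def by (metis val.simps(5))

text \<open>A new value in front of \<open>env e\<close> moves every index by one and so exchanges
  parities; this renaming restores the interleaving.\<close>

definition shift_env :: "nat \<Rightarrow> tm" where
  "shift_env i = (if i = 0 then \<^bold>v 0 else if even i then \<^bold>v (i - 1) else \<^bold>v (i + 1))"

lemma shift_env: "(\<lambda>i. val (case_nat x (env e)) (shift_env i)) = env (case_nat x e)"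
  by (auto simp: fun_eq_iff shift_env_def env_def double_not_eq_Suc_double
      elim!: evenE oddE split: nat.split)

definition tail_env :: "nat \<Rightarrow> tm" where
  "tail_env i = (if even i then \<^bold>v (i + 2) else \<^bold>v i)"

lemma tail_env: "(\<lambda>i. val (env e) (tail_env i)) = env (\<lambda>i. e (Suc i))"
  by (auto simp: fun_eq_iff tail_env_def env_def)

lemma term_fun_tail: "term_fun f \<Longrightarrow> term_fun (\<lambda>e. f (\<lambda>i. e (Suc i)))"
  unfolding term_fun_def
proof (elim exE)
  fix t assume "\<forall>e. f e = val (env e) t"
  then show "\<exists>t. \<forall>e. f (\<lambda>i. e (Suc i)) = val (env e) t"
    by (intro exI[of _ "subst_tm tail_env t"]) (simp add: val_subst_tm tail_env)
qed

lemma definable_eq [definable_intros]: "term_fun f \<Longrightarrow> term_fun g \<Longrightarrow> definable (\<lambda>Z e. f e = g e)"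
  unfolding term_fun_def definable_def by (metis sat.simps(2) arithmetical.simps(2))

lemma definable_less [definable_intros]: "term_fun f \<Longrightarrow> term_fun g \<Longrightarrow> definable (\<lambda>Z e. f e \<prec> g e)"
  unfolding term_fun_def definable_def by (metis sat.simps(3) arithmetical.simps(3))

lemma definable_mem_var [definable_intros]: "term_fun f \<Longrightarrow> definable (\<lambda>Z e. f e \<in> Z)"
  unfolding term_fun_def definable_def
proof (elim exE)
  fix t assume "\<forall>e. f e = val (env e) t"
  then show "\<exists>\<phi>. arithmetical \<phi> \<and> (\<forall>Z e. f e \<in> Z \<longleftrightarrow> sat (env e) (case_nat Z (from_nat_into SS)) \<phi>)"
    by (intro exI[of _ "t \<^bold>\<in> 0"]) simp
qed

lemma definable_mem [definable_intros]: "X \<in> SS \<Longrightarrow> term_fun f \<Longrightarrow> definable (\<lambda>Z e. f e \<in> X)"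
  unfolding term_fun_def definable_def
proof (elim exE)
  fix t assume "\<forall>e. f e = val (env e) t" and X: "X \<in> SS"
  moreover obtain n where "from_nat_into SS n = X"
    using from_nat_into_surj[OF countable_sets X] by blast
  ultimately show "\<exists>\<phi>. arithmetical \<phi> \<and> (\<forall>Z e. f e \<in> X \<longleftrightarrow> sat (env e) (case_nat Z (from_nat_into SS)) \<phi>)"
    by (intro exI[of _ "t \<^bold>\<in> Suc n"]) simp
qed

lemma definable_const [definable_intros]: "definable (\<lambda>Z e. c)"
proof -
  have "definable (\<lambda>Z e. \<zero> = \<zero>)" by (intro definable_intros)
  moreover have "definable (\<lambda>Z e. False)" unfolding definable_def by (intro exI[of _ "\<^bold>\<bottom>"]) simp
  ultimately show ?thesis by (cases c) auto
qed

lemma definable_imp [definable_intros]: "definable P \<Longrightarrow> definable Q \<Longrightarrow> definable (\<lambda>Z e. P Z e \<longrightarrow> Q Z e)"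
  unfolding definable_def by (metis sat.simps(5) arithmetical.simps(5))

lemma definable_not [definable_intros]: "definable P \<Longrightarrow> definable (\<lambda>Z e. \<not> P Z e)"
  using definable_imp[OF _ definable_const, of P False] by simp

lemma definable_or [definable_intros]: "definable P \<Longrightarrow> definable Q \<Longrightarrow> definable (\<lambda>Z e. P Z e \<or> Q Z e)"
  using definable_imp[OF definable_not, of P Q] by (simp add: disj_imp)

lemma definable_and [definable_intros]: "definable P \<Longrightarrow> definable Q \<Longrightarrow> definable (\<lambda>Z e. P Z e \<and> Q Z e)"
  using definable_not[OF definable_imp[OF _ definable_not, of P Q]] by simp

lemma definable_iff [definable_intros]: "definable P \<Longrightarrow> definable Q \<Longrightarrow> definable (\<lambda>Z e. P Z e \<longleftrightarrow> Q Z e)"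
  using definable_and[OF definable_imp[of P Q] definable_imp[of Q P]] by (simp add: iff_conv_conj_imp)

text \<open>The bound variable is entry 0 and the outer environment is the tail, so nested
  quantifiers are handled by unification alone.\<close>

lemma definable_all [definable_intros]:
  assumes "definable (\<lambda>Z e. Q Z (e 0) (\<lambda>i. e (Suc i)))"
  shows "definable (\<lambda>Z e. \<forall>x. Q Z x e)"
proof -
  obtain \<phi> where \<phi>: "arithmetical \<phi>"
    "Q Z (e 0) (\<lambda>i. e (Suc i)) \<longleftrightarrow> sat (env e) (case_nat Z (from_nat_into SS)) \<phi>" for Z e
    using assms unfolding definable_def by blast
  have "Q Z x e \<longleftrightarrow> sat (case_nat x (env e)) (case_nat Z (from_nat_into SS)) (subst shift_env id \<phi>)" for Z x e
    using \<phi>(2)[of Z "case_nat x e"] by (simp add: sat_subst shift_env)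
  then show ?thesis
    unfolding definable_def using \<phi>(1)
    by (intro exI[of _ "AllN (subst shift_env id \<phi>)"]) (simp add: arithmetical_subst)
qed

lemma definable_ex [definable_intros]: "definable (\<lambda>Z e. Q Z (e 0) (\<lambda>i. e (Suc i))) \<Longrightarrow> definable (\<lambda>Z e. \<exists>x. Q Z x e)"
  using definable_not[OF definable_all, of "\<lambda>Z x e. \<not> Q Z x e"] definable_not by simp

lemma term_fun_val: "(\<And>i. term_fun (\<lambda>e. f e i)) \<Longrightarrow> term_fun (\<lambda>e. val (f e) t)"
  by (induction t) (auto intro: definable_intros)

text \<open>The bridge from formulas given as syntax, namely the matrix of the \<Sigma>11 formula
  and membership by canonical index, to \<open>definable\<close>.\<close>

lemma definable_sat:
  assumes "arithmetical \<theta>" "\<And>i. term_fun (\<lambda>e. f e i)" "\<And>n t. term_fun t \<Longrightarrow> definable (\<lambda>Z e. t e \<in> G Z n)"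
  shows "definable (\<lambda>Z e. sat (f e) (G Z) \<theta>)"
  using assms(1,2)
proof (induction \<theta> arbitrary: f)
  case (AllN \<theta>)
  have "term_fun (\<lambda>e. case_nat (e 0) (f (\<lambda>i. e (Suc i))) i)" for i
    using term_fun_tail[OF AllN.prems(2)] by (cases i) (auto intro: definable_intros)
  then show ?case using AllN by (simp add: definable_all)
qed (auto intro!: definable_intros term_fun_val assms(3))

lemma definable_comprehension_all:
  assumes "definable (\<lambda>Z e. Q Z (e 0))"
  shows "{x. \<forall>Z\<in>SS. Q Z x} \<in> SS"
proof -
  obtain \<phi> where \<phi>: "arithmetical \<phi>"
    "Q Z (e 0) \<longleftrightarrow> sat (env e) (case_nat Z (from_nat_into SS)) \<phi>" for Z e
    using assms unfolding definable_def by blast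
  have "Q Z x \<longleftrightarrow> sat (case_nat x (env e)) (case_nat Z (from_nat_into SS)) (subst shift_env id \<phi>)" for Z x e
    using \<phi>(2)[of Z "case_nat x e"] by (simp add: sat_subst shift_env)
  then show ?thesis
    \<comment> \<open>\<open>undefined\<close> fills the environment behind entry 0, the only entry
      that \<open>Q\<close> reads.\<close>
    using Pi11_comprehension[of "subst shift_env id \<phi>" "from_nat_into SS" "env undefined"] \<phi>(1)
    by (simp add: image_subset_iff arithmetical_subst)
qed

lemma definable_comprehension:
  assumes "definable (\<lambda>Z e. Q (e 0))"
  shows "{x. Q x} \<in> SS"
  using definable_comprehension_all[of "\<lambda>Z. Q"] assms sets_nonempty by (simp add: ex_in_conv[symmetric])

text \<open>\<Sigma>11 comprehension: the complement is \<Pi>11, and arithmetical comprehension with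
  that set as a parameter complements it again.\<close>

lemma definable_comprehension_ex:
  assumes "definable (\<lambda>Z e. Q Z (e 0))"
  shows "{x. \<exists>Z\<in>SS. Q Z x} \<in> SS"
proof -
  have "{x. \<forall>Z\<in>SS. \<not> Q Z x} \<in> SS" by (intro definable_comprehension_all definable_not assms)
  from definable_comprehension[OF definable_not[OF definable_mem[OF this term_fun_var[of 0]]]] show ?thesis by simp
qed

section \<open>Arithmetic in a model\<close>

lemma sat_basic: "\<phi> \<in> basic_axioms \<Longrightarrow> sat e (from_nat_into SS) \<phi>"
  by (rule sat_axiom) (auto simp: Pi11_CA0_def)

lemma Suc_not_zero [simp]: "x \<oplus> \<one> \<noteq> \<zero>" "\<zero> \<noteq> x \<oplus> \<one>"
  using sat_basic[of "\<^bold>\<not> (\<^bold>v 0 \<^bold>+ \<^bold>1 \<^bold>= \<^bold>0)" "\<lambda>_. x"] by (auto simp: basic_axioms_def)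

lemma Suc_inject [simp]: "x \<oplus> \<one> = y \<oplus> \<one> \<longleftrightarrow> x = y"
  using sat_basic[of "\<^bold>v 0 \<^bold>+ \<^bold>1 \<^bold>= \<^bold>v 1 \<^bold>+ \<^bold>1 \<^bold>\<longrightarrow> \<^bold>v 0 \<^bold>= \<^bold>v 1" "case_nat x (\<lambda>_. y)"]
  by (auto simp: basic_axioms_def)

lemma add_zero [simp]: "x \<oplus> \<zero> = x"
  using sat_basic[of "\<^bold>v 0 \<^bold>+ \<^bold>0 \<^bold>= \<^bold>v 0" "\<lambda>_. x"] by (auto simp: basic_axioms_def)

lemma add_Suc: "x \<oplus> (y \<oplus> \<one>) = (x \<oplus> y) \<oplus> \<one>"
  using sat_basic[of "\<^bold>v 0 \<^bold>+ (\<^bold>v 1 \<^bold>+ \<^bold>1) \<^bold>= (\<^bold>v 0 \<^bold>+ \<^bold>v 1) \<^bold>+ \<^bold>1" "case_nat x (\<lambda>_. y)"]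
  by (auto simp: basic_axioms_def)

lemma mult_zero [simp]: "x \<otimes> \<zero> = \<zero>"
  using sat_basic[of "\<^bold>v 0 \<^bold>* \<^bold>0 \<^bold>= \<^bold>0" "\<lambda>_. x"] by (auto simp: basic_axioms_def)

lemma mult_Suc: "x \<otimes> (y \<oplus> \<one>) = x \<otimes> y \<oplus> x"
  using sat_basic[of "\<^bold>v 0 \<^bold>* (\<^bold>v 1 \<^bold>+ \<^bold>1) \<^bold>= \<^bold>v 0 \<^bold>* \<^bold>v 1 \<^bold>+ \<^bold>v 0" "case_nat x (\<lambda>_. y)"]
  by (auto simp: basic_axioms_def)

lemma not_less_zero [simp]: "\<not> x \<prec> \<zero>"
  using sat_basic[of "\<^bold>\<not> (\<^bold>v 0 \<^bold>< \<^bold>0)" "\<lambda>_. x"] by (auto simp: basic_axioms_def)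

lemma less_Suc: "x \<prec> y \<oplus> \<one> \<longleftrightarrow> x \<prec> y \<or> x = y"
  using sat_basic[of "\<^bold>v 0 \<^bold>< \<^bold>v 1 \<^bold>+ \<^bold>1 \<^bold>\<longleftrightarrow> \<^bold>v 0 \<^bold>< \<^bold>v 1 \<^bold>\<or> \<^bold>v 0 \<^bold>= \<^bold>v 1" "case_nat x (\<lambda>_. y)"]
  by (auto simp: basic_axioms_def)

text \<open>The induction axiom speaks about sets of the model, so each induction carries a
  definability goal, which turns the property into such a set.\<close>

lemma definable_induct [consumes 1, case_names definable zero Suc]:
  assumes "definable (\<lambda>Z e. P (e 0))" "P \<zero>" "\<And>x. P x \<Longrightarrow> P (x \<oplus> \<one>)"
  shows "P x"
proof -
  have "{x. P x} \<in> SS" by (rule definable_comprehension) fact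
  moreover have "sat (\<lambda>_. \<zero>) (\<lambda>_. {x. P x}) induction_axiom"
    using calculation by (intro sat_axiom) (auto simp: Pi11_CA0_def)
  ultimately show ?thesis using assms(2,3) by (simp add: induction_axiom_def)
qed

lemma add_assoc: "(x \<oplus> y) \<oplus> z = x \<oplus> (y \<oplus> z)"
  by (rule definable_induct[of _ z]) (auto intro!: definable_intros simp: add_Suc)

lemma zero_add [simp]: "\<zero> \<oplus> x = x"
  by (rule definable_induct[of _ x]) (auto intro!: definable_intros simp: add_Suc)

lemma Suc_add: "(x \<oplus> \<one>) \<oplus> y = (x \<oplus> y) \<oplus> \<one>"
  by (rule definable_induct[of _ y]) (auto intro!: definable_intros simp: add_Suc)

lemma add_commute: "x \<oplus> y = y \<oplus> x"
  by (rule definable_induct[of _ y]) (auto intro!: definable_intros simp: add_Suc Suc_add)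

lemma add_left_commute: "x \<oplus> (y \<oplus> z) = y \<oplus> (x \<oplus> z)"
  by (metis add_assoc add_commute)

lemmas add_ac = add_assoc add_commute add_left_commute

lemma add_right_cancel [simp]: "x \<oplus> z = y \<oplus> z \<longleftrightarrow> x = y"
  by (rule definable_induct[of _ z]) (auto intro!: definable_intros simp flip: add_assoc)

lemma add_left_cancel [simp]: "z \<oplus> x = z \<oplus> y \<longleftrightarrow> x = y"
  by (metis add_commute add_right_cancel)

lemma zero_mult [simp]: "\<zero> \<otimes> x = \<zero>"
  by (rule definable_induct[of _ x]) (auto intro!: definable_intros simp: mult_Suc)

lemma Suc_mult: "(x \<oplus> \<one>) \<otimes> y = x \<otimes> y \<oplus> y"
  by (rule definable_induct[of _ y]) (auto intro!: definable_intros simp: mult_Suc add_ac)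

lemma mult_commute: "x \<otimes> y = y \<otimes> x"
  by (rule definable_induct[of _ y]) (auto intro!: definable_intros simp: mult_Suc Suc_mult)

lemma distrib_left: "x \<otimes> (y \<oplus> z) = x \<otimes> y \<oplus> x \<otimes> z"
  by (rule definable_induct[of _ z]) (auto intro!: definable_intros simp: mult_Suc simp flip: add_assoc)

lemma distrib_right: "(y \<oplus> z) \<otimes> x = y \<otimes> x \<oplus> z \<otimes> x"
  by (metis distrib_left mult_commute)

lemma mult_one [simp]: "x \<otimes> \<one> = x" "\<one> \<otimes> x = x"
  using mult_Suc[of x \<zero>] Suc_mult[of \<zero> x] by simp_all

lemma zero_or_Suc: "x = \<zero> \<or> (\<exists>y. x = y \<oplus> \<one>)"
  by (rule definable_induct[of _ x]) (auto intro!: definable_intros)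

lemma less_iff: "x \<prec> y \<longleftrightarrow> (\<exists>z. y = x \<oplus> (z \<oplus> \<one>))"
proof (rule definable_induct[of _ y])
  fix y assume "x \<prec> y \<longleftrightarrow> (\<exists>z. y = x \<oplus> (z \<oplus> \<one>))"
  then show "x \<prec> y \<oplus> \<one> \<longleftrightarrow> (\<exists>z. y \<oplus> \<one> = x \<oplus> (z \<oplus> \<one>))"
  proof -
    have "(\<exists>z. y \<oplus> \<one> = x \<oplus> (z \<oplus> \<one>)) \<longleftrightarrow> (\<exists>z. y = x \<oplus> z)" by (simp add: add_Suc)
    also have "\<dots> \<longleftrightarrow> y = x \<or> (\<exists>z. y = x \<oplus> (z \<oplus> \<one>))" by (metis add_zero zero_or_Suc)
    finally show ?thesis using \<open>x \<prec> y \<longleftrightarrow> _\<close> by (auto simp: less_Suc)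
  qed
qed (auto intro!: definable_intros simp: add_Suc)

lemma less_irrefl [simp]: "\<not> x \<prec> x"
  unfolding less_iff by (metis Suc_not_zero(1) add_left_cancel add_zero)

lemma linear: "x \<prec> y \<or> x = y \<or> y \<prec> x"
proof (rule definable_induct[of _ y])
  fix y assume "x \<prec> y \<or> x = y \<or> y \<prec> x"
  then show "x \<prec> y \<oplus> \<one> \<or> x = y \<oplus> \<one> \<or> y \<oplus> \<one> \<prec> x"
  proof (elim disjE)
    assume "y \<prec> x"
    then obtain z where z: "x = y \<oplus> (z \<oplus> \<one>)" unfolding less_iff by blast
    show ?thesis
    proof (cases "z = \<zero>")
      case False
      then obtain w where "x = (y \<oplus> \<one>) \<oplus> (w \<oplus> \<one>)" using z zero_or_Suc[of z] by (auto simp: add_ac)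
      then show ?thesis unfolding less_iff[of "y \<oplus> \<one>"] by blast
    qed (use z in simp)
  qed (auto simp: less_Suc)
qed (use zero_or_Suc[of x] in \<open>auto intro!: definable_intros simp: less_iff\<close>)

lemma strong_induct:
  assumes "definable (\<lambda>Z e. P (e 0))" "\<And>x. (\<And>y. y \<prec> x \<Longrightarrow> P y) \<Longrightarrow> P x"
  shows "P x"
proof -
  have S: "{x. P x} \<in> SS" by (rule definable_comprehension) fact
  \<comment> \<open>Membership in the set \<open>{x. P x}\<close> replaces \<open>P\<close>, so that
    the closure rules apply under the bounded quantifier.\<close>
  have "\<forall>y. y \<prec> x \<longrightarrow> y \<in> {x. P x}"
    by (rule definable_induct[of _ x]) (intro definable_intros S, use assms(2) in \<open>auto simp: less_Suc\<close>)
  then show ?thesis using assms(2) by auto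
qed

lemma least_number:
  assumes "definable (\<lambda>Z e. P (e 0))" "P x"
  shows "\<exists>y. P y \<and> (\<forall>z. z \<prec> y \<longrightarrow> \<not> P z)"
  using strong_induct[of "\<lambda>x. \<not> P x" x] assms definable_not[OF assms(1)] by blast

definition pair_val :: "'a \<Rightarrow> 'a \<Rightarrow> 'a" where
  "pair_val s t = (s \<oplus> t) \<otimes> (s \<oplus> t) \<oplus> s"

lemma term_fun_pair_val [definable_intros]: "term_fun f \<Longrightarrow> term_fun g \<Longrightarrow> term_fun (\<lambda>e. pair_val (f e) (g e))"
  unfolding pair_val_def by (intro definable_intros)

text \<open>For n = s + t the code lies between n^2 and n^2 + n, hence below (n + 1)^2. So a code
  determines the sum, and then the first component.\<close>

lemma pair_val_less:
  assumes "s \<oplus> t \<prec> s' \<oplus> t'"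
  shows "pair_val s t \<prec> pair_val s' t'"
proof -
  obtain z where z: "s' \<oplus> t' = s \<oplus> t \<oplus> (z \<oplus> \<one>)" using assms by (auto simp: less_iff)
  \<comment> \<open>The difference (n + z + 1)^2 + s' - (n^2 + s) multiplied out for n = s + t, with
    one copy of s cancelled to avoid subtraction.\<close>
  have "pair_val s' t' = pair_val s t \<oplus> ((s \<otimes> z \<oplus> t \<otimes> z \<oplus> t \<oplus> z \<otimes> s \<oplus> z \<otimes> t \<oplus> s \<oplus> t \<oplus> z \<otimes> z \<oplus> z \<oplus> z \<oplus> s') \<oplus> \<one>)"
    unfolding pair_val_def z by (simp add: distrib_left distrib_right add_ac)
  then show ?thesis unfolding less_iff by blast
qed

lemma pair_val_inject [simp]: "pair_val s t = pair_val s' t' \<longleftrightarrow> s = s' \<and> t = t'"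
proof
  assume *: "pair_val s t = pair_val s' t'"
  then have "s \<oplus> t = s' \<oplus> t'"
    using linear[of "s \<oplus> t" "s' \<oplus> t'"] pair_val_less less_irrefl by metis
  moreover have "s = s'" using * calculation by (simp add: pair_val_def)
  ultimately show "s = s' \<and> t = t'" by simp
qed simp

text \<open>Since n^2 is at least n, a code is at least its second component. This makes a stage
  with second component \<open>t\<close> come no earlier than \<open>t\<close>.\<close>

lemma pair_val_ge: "\<exists>w. pair_val s t = t \<oplus> w"
proof -
  obtain w where "(s \<oplus> t) \<otimes> (s \<oplus> t) = (s \<oplus> t) \<oplus> w"
  proof (cases "s \<oplus> t = \<zero>")
    case False
    then obtain b where "s \<oplus> t = b \<oplus> \<one>" using zero_or_Suc by blast
    then show ?thesis using that[of "(b \<oplus> \<one>) \<otimes> b"] by (simp only: mult_Suc add_commute)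
  qed (use that in simp)
  then have "pair_val s t = t \<oplus> (s \<oplus> w \<oplus> s)" unfolding pair_val_def by (simp add: add_ac)
  then show ?thesis by blast
qed

lemma remainder_unique:
  assumes "q \<otimes> m \<oplus> r = q' \<otimes> m \<oplus> r'" "r \<prec> m" "r' \<prec> m"
  shows "r = r'"
proof -
  have False if *: "q \<otimes> m \<oplus> r = q' \<otimes> m \<oplus> r'" "r \<prec> m" "q \<prec> q'" for q q' r r'
  proof -
    obtain y where y: "m = r \<oplus> (y \<oplus> \<one>)" using *(2) by (auto simp: less_iff)
    obtain z where z: "q' = q \<oplus> (z \<oplus> \<one>)" using *(3) by (auto simp: less_iff)
    \<comment> \<open>The variable \<open>k\<close> isolates the one copy of \<open>m\<close> that
      is to be rewritten as \<open>r \<oplus> (y \<oplus> \<one>)\<close>.\<close>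
    have "q' \<otimes> m = q \<otimes> m \<oplus> (z \<otimes> m \<oplus> k)" if "k = m" for k
      unfolding z that by (simp add: distrib_right)
    from this[OF y[symmetric]]
    have "q' \<otimes> m \<oplus> r' = (q \<otimes> m \<oplus> r) \<oplus> ((z \<otimes> m \<oplus> y \<oplus> r') \<oplus> \<one>)"
      by (simp add: add_ac)
    then show False using *(1) less_irrefl less_iff by metis
  qed
  from this[OF assms(1,2)] this[OF assms(1)[symmetric] assms(3)] linear[of q q'] show ?thesis
    using assms(1) by auto
qed

section \<open>Inductive definitions and codes of finite sets\<close>

lemma definable_inst:
  assumes "definable P" "X \<in> SS"
  shows "definable (\<lambda>_. P X)"
proof -
  obtain \<phi> where \<phi>: "arithmetical \<phi>" "\<And>Z e. P Z e \<longleftrightarrow> sat (env e) (case_nat Z (from_nat_into SS)) \<phi>"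
    using assms unfolding definable_def by blast
  obtain n where n: "from_nat_into SS n = X"
    using from_nat_into_surj[OF countable_sets assms(2)] by blast
  have "(\<lambda>i. case_nat Z (from_nat_into SS) (case_nat (Suc n) Suc i)) = case_nat X (from_nat_into SS)" for Z
    by (auto simp: fun_eq_iff n split: nat.split)
  then show ?thesis
    unfolding definable_def using \<phi>
    by (intro exI[of _ "subst Var (case_nat (Suc n) Suc) \<phi>"]) (simp add: sat_subst arithmetical_subst)
qed

text \<open>The Knaster-Tarski argument inside the model: the intersection of all closed sets is
  \<Pi>11. It is least only among sets of the model, so its image under \<Gamma> has to be shown to
  be one of them. Recursion in the model rests on this.\<close>

lemma inductive_definition:
  assumes definable: "definable (\<lambda>Z e. \<Gamma> Z (e 0))" and mono: "\<And>Z Z' x. Z \<subseteq> Z' \<Longrightarrow> \<Gamma> Z x \<Longrightarrow> \<Gamma> Z' x"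
  shows "\<exists>I\<in>SS. \<forall>x. x \<in> I \<longleftrightarrow> \<Gamma> I x"
proof -
  define I where "I = {x. \<forall>Z\<in>SS. (\<forall>y. \<Gamma> Z y \<longrightarrow> y \<in> Z) \<longrightarrow> x \<in> Z}"
  have I: "I \<in> SS"
    unfolding I_def by (intro definable_comprehension_all definable_imp definable_all definable_mem_var term_fun_var definable)
  have least: "I \<subseteq> Z" if "Z \<in> SS" "\<And>y. \<Gamma> Z y \<Longrightarrow> y \<in> Z" for Z
    unfolding I_def using that by blast
  have closed: "x \<in> I" if "\<Gamma> I x" for x
  proof -
    have "x \<in> Z" if "Z \<in> SS" "\<forall>y. \<Gamma> Z y \<longrightarrow> y \<in> Z" for Z
      using mono[OF least \<open>\<Gamma> I x\<close>] that by simp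
    then show ?thesis unfolding I_def by simp
  qed
  have "I \<subseteq> {x. \<Gamma> I x}"
  proof (rule least)
    show "{x. \<Gamma> I x} \<in> SS" by (intro definable_comprehension definable_inst[OF definable I])
    show "y \<in> {x. \<Gamma> I x}" if "\<Gamma> {x. \<Gamma> I x} y" for y
      using mono[OF _ that, of I] closed by auto
  qed
  then have "\<forall>x. x \<in> I \<longleftrightarrow> \<Gamma> I x" using closed by auto
  then show ?thesis by (rule bexI[OF _ I])
qed

text \<open>Finite sets are coded by lists, 0 for the empty set and \<open>cons c x\<close> for the set coded by \<open>c\<close> with
  \<open>x\<close> added. The membership relation is itself given by an inductive definition, hence by
  \<open>\<Pi>\<^sup>1\<^sub>1\<close> comprehension, which spares the \<open>\<beta>\<close>-function lemma inside the model.\<close>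

definition cons :: "'a \<Rightarrow> 'a \<Rightarrow> 'a" where
  "cons c x = pair_val c x \<oplus> \<one>"

lemma finite_set_codes:
  "\<exists>M\<in>SS. (\<forall>x. pair_val x \<zero> \<notin> M) \<and> (\<forall>x c y. pair_val x (cons c y) \<in> M \<longleftrightarrow> x = y \<or> pair_val x c \<in> M)"
proof -
  define \<Gamma> where "\<Gamma> Z n \<longleftrightarrow> (\<exists>x c y. n = pair_val x (cons c y) \<and> (x = y \<or> pair_val x c \<in> Z))" for Z n
  have "\<exists>I\<in>SS. \<forall>x. x \<in> I \<longleftrightarrow> \<Gamma> I x"
  proof (rule inductive_definition)
    show "definable (\<lambda>Z e. \<Gamma> Z (e 0))" unfolding \<Gamma>_def cons_def by (intro definable_intros)
  qed (auto simp: \<Gamma>_def)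
  then obtain M where M: "M \<in> SS" "\<And>x. x \<in> M \<longleftrightarrow> \<Gamma> M x" by blast
  have "pair_val x \<zero> \<notin> M" for x
    by (subst M(2)) (auto simp: \<Gamma>_def cons_def)
  moreover have "pair_val x (cons c y) \<in> M \<longleftrightarrow> x = y \<or> pair_val x c \<in> M" for x c y
    by (subst M(2)) (auto simp: \<Gamma>_def cons_def)
  ultimately show ?thesis using M(1) by blast
qed

section \<open>Canonical indices in the model\<close>

definition beta_val :: "'a \<Rightarrow> 'a \<Rightarrow> 'a \<Rightarrow> 'a \<Rightarrow> bool" where
  "beta_val c d j r \<longleftrightarrow> r \<prec> (j \<oplus> \<one>) \<otimes> d \<oplus> \<one> \<and> (\<exists>q. c = q \<otimes> ((j \<oplus> \<one>) \<otimes> d \<oplus> \<one>) \<oplus> r)"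

definition power_two_val :: "'a \<Rightarrow> 'a \<Rightarrow> bool" where
  "power_two_val x p \<longleftrightarrow> (\<exists>c d. beta_val c d \<zero> \<one> \<and> (\<forall>j. j \<prec> x \<longrightarrow> (\<exists>r. beta_val c d j r \<and> beta_val c d (j \<oplus> \<one>) (r \<oplus> r))) \<and> beta_val c d x p)"

definition canon_val :: "'a \<Rightarrow> 'a \<Rightarrow> bool" where
  "canon_val x k \<longleftrightarrow> (\<exists>p a b. power_two_val x p \<and> b \<prec> p \<and> k = a \<otimes> (p \<oplus> p) \<oplus> (p \<oplus> b))"

lemma sat_beta: "sat e E (beta c d j r) \<longleftrightarrow> beta_val (val e c) (val e d) (val e j) (val e r)"
  by (simp add: beta_def beta_val_def Let_def)

lemma sat_power_two: "sat e E (power_two x p) \<longleftrightarrow> power_two_val (val e x) (val e p)"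
  by (simp add: power_two_def power_two_val_def sat_beta eval_nat_numeral)

lemma sat_canon_mem: "sat e E (canon_mem x k) \<longleftrightarrow> canon_val (val e x) (val e k)"
  by (simp add: canon_mem_def canon_val_def sat_power_two eval_nat_numeral)

lemma arithmetical_canon_mem: "arithmetical (canon_mem x k)"
  by (simp add: canon_mem_def power_two_def beta_def Let_def)

lemma definable_canon_val [definable_intros]:
  assumes "term_fun f" "term_fun g"
  shows "definable (\<lambda>Z e. canon_val (f e) (g e))"
proof -
  \<comment> \<open>The formula has the free variables 0 and 1 and no set variable;
    \<open>g e\<close> pads the environment and the empty set interprets every set variable.\<close>
  have "definable (\<lambda>Z e. sat (case_nat (f e) (\<lambda>_. g e)) ((\<lambda>Z _. {}) Z) (canon_mem (\<^bold>v 0) (\<^bold>v 1)))"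
  proof (rule definable_sat[OF arithmetical_canon_mem])
    show "term_fun (\<lambda>e. case_nat (f e) (\<lambda>_. g e) i)" for i
      using assms by (cases i) auto
  qed (auto intro!: definable_const)
  then show ?thesis by (simp add: sat_canon_mem)
qed

lemma beta_val_unique: "beta_val c d j r \<Longrightarrow> beta_val c d j r' \<Longrightarrow> r = r'"
  unfolding beta_val_def using remainder_unique by metis

lemma less_add: "x \<prec> y \<Longrightarrow> x \<prec> y \<oplus> z"
proof -
  assume "x \<prec> y"
  then obtain u where "y = x \<oplus> (u \<oplus> \<one>)" by (auto simp: less_iff)
  then have "y \<oplus> z = x \<oplus> ((u \<oplus> z) \<oplus> \<one>)" by (simp add: add_ac)
  then show ?thesis unfolding less_iff by blast
qed

lemma Suc_less_Suc: "x \<oplus> \<one> \<prec> y \<oplus> \<one> \<Longrightarrow> x \<prec> y"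
proof -
  assume "x \<oplus> \<one> \<prec> y \<oplus> \<one>"
  then obtain z where "y \<oplus> \<one> = (x \<oplus> \<one>) \<oplus> (z \<oplus> \<one>)" by (auto simp: less_iff)
  then have "y \<oplus> \<one> = (x \<oplus> (z \<oplus> \<one>)) \<oplus> \<one>" by (simp add: add_ac)
  then show ?thesis by (auto simp: less_iff)
qed

text \<open>Along the coded sequence, entry j exceeds j: doubling an entry of at least j + 1 gives
  at least 2 j + 2. The doubling is known only below \<open>x\<close>, hence the bound on j in the
  induction.\<close>

lemma power_two_val_gt:
  assumes "power_two_val x p"
  shows "x \<prec> p"
proof -
  obtain c d where cd: "beta_val c d \<zero> \<one>" "beta_val c d x p"
    "\<And>j. j \<prec> x \<Longrightarrow> \<exists>r. beta_val c d j r \<and> beta_val c d (j \<oplus> \<one>) (r \<oplus> r)"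
    using assms unfolding power_two_val_def by blast
  have "j \<prec> x \<oplus> \<one> \<longrightarrow> (\<exists>r. beta_val c d j r \<and> j \<prec> r)" for j
  proof (rule definable_induct[of _ j])
    show "definable (\<lambda>Z e. e 0 \<prec> x \<oplus> \<one> \<longrightarrow> (\<exists>r. beta_val c d (e 0) r \<and> e 0 \<prec> r))"
      unfolding beta_val_def by (intro definable_intros)
    have "\<zero> \<prec> \<one>" using less_Suc[of \<zero> \<zero>] by simp
    then show "\<zero> \<prec> x \<oplus> \<one> \<longrightarrow> (\<exists>r. beta_val c d \<zero> r \<and> \<zero> \<prec> r)" using cd(1) by blast
    fix j assume IH: "j \<prec> x \<oplus> \<one> \<longrightarrow> (\<exists>r. beta_val c d j r \<and> j \<prec> r)"
    show "j \<oplus> \<one> \<prec> x \<oplus> \<one> \<longrightarrow> (\<exists>r. beta_val c d (j \<oplus> \<one>) r \<and> j \<oplus> \<one> \<prec> r)"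
    proof
      assume "j \<oplus> \<one> \<prec> x \<oplus> \<one>"
      then have j: "j \<prec> x" by (rule Suc_less_Suc)
      obtain r where r: "beta_val c d j r" "j \<prec> r" using IH j less_Suc by blast
      obtain r' where r': "beta_val c d j r'" "beta_val c d (j \<oplus> \<one>) (r' \<oplus> r')" using cd(3)[OF j] by blast
      have [simp]: "r' = r" using beta_val_unique r r' by blast
      obtain k where "r = j \<oplus> (k \<oplus> \<one>)" using r(2) by (auto simp: less_iff)
      then have "r \<oplus> r = (j \<oplus> \<one>) \<oplus> ((j \<oplus> k \<oplus> k) \<oplus> \<one>)" by (simp add: add_ac)
      then have "j \<oplus> \<one> \<prec> r \<oplus> r" unfolding less_iff by blast
      then show "\<exists>r. beta_val c d (j \<oplus> \<one>) r \<and> j \<oplus> \<one> \<prec> r" using r' by auto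
    qed
  qed
  from this[of x] show ?thesis using beta_val_unique cd(2) less_Suc by blast
qed

text \<open>From x < 2^x and 2^x \<le> k: the premise with canonical index \<open>k\<close> is
  bounded by \<open>k\<close>, hence finite in the sense of the model.\<close>

lemma canon_val_less:
  assumes "canon_val x k"
  shows "x \<prec> k"
proof -
  obtain p a b where "power_two_val x p" and k: "k = a \<otimes> (p \<oplus> p) \<oplus> (p \<oplus> b)"
    using assms unfolding canon_val_def by blast
  then have "x \<prec> p \<oplus> (b \<oplus> a \<otimes> (p \<oplus> p))" by (intro less_add power_two_val_gt)
  then show ?thesis unfolding k by (simp add: add_ac)
qed

end

section \<open>Maximal closed sets in a model\<close>

text \<open>\<open>\<Theta> Y X\<close> stands for the arithmetical matrix with witness
  \<open>Y\<close>. Its definability is asked on two columns of one set because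
  \<open>definable\<close> has a single set slot.\<close>

locale closure_problem = Pi11_model +
  fixes F S A B :: "'a set" and \<Theta> :: "'a set \<Rightarrow> 'a set \<Rightarrow> bool"
  assumes sets: "F \<in> SS" "S \<in> SS" "A \<in> SS" "B \<in> SS"
    and definable_Theta: "definable (\<lambda>Z e. \<Theta> {x. pair_val x \<one> \<in> Z} {x. pair_val x \<zero> \<in> Z})"
begin

definition \<Phi> :: "'a set \<Rightarrow> bool" where
  "\<Phi> X \<longleftrightarrow> (\<exists>Y\<in>SS. \<Theta> Y X)"

definition closed_under :: "'a set \<Rightarrow> bool" where
  "closed_under X \<longleftrightarrow> (\<forall>i k. pair_val i k \<in> F \<longrightarrow> (\<forall>x. canon_val x k \<longrightarrow> x \<in> X) \<longrightarrow> (\<exists>w. w \<in> X \<and> pair_val w i \<in> S))"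

definition Sol :: "'a set \<Rightarrow> bool" where
  "Sol X \<longleftrightarrow> closed_under X \<and> X \<subseteq> A \<and> \<Phi> X"

text \<open>The solution \<open>X\<close> and the witness \<open>Y\<close> of its \<open>\<Sigma>\<^sup>1\<^sub>1\<close> property are merged into one set \<open>Z\<close> with
  columns \<open>X\<close> and \<open>Y\<close>, so that a single set quantifier remains.\<close>

lemma extendible_codes:
  assumes "M \<in> SS"
  shows "{c. \<exists>X\<in>SS. Sol X \<and> B \<subseteq> X \<and> (\<forall>x. pair_val x c \<in> M \<longrightarrow> x \<in> X)} \<in> SS"
proof -
  define Q where "Q Z c \<longleftrightarrow>
    (\<forall>i k. pair_val i k \<in> F \<longrightarrow> (\<forall>x. canon_val x k \<longrightarrow> pair_val x \<zero> \<in> Z) \<longrightarrow> (\<exists>w. pair_val w \<zero> \<in> Z \<and> pair_val w i \<in> S)) \<and>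
    (\<forall>x. pair_val x \<zero> \<in> Z \<longrightarrow> x \<in> A) \<and> (\<forall>x. x \<in> B \<longrightarrow> pair_val x \<zero> \<in> Z) \<and>
    (\<forall>x. pair_val x c \<in> M \<longrightarrow> pair_val x \<zero> \<in> Z) \<and> \<Theta> {x. pair_val x \<one> \<in> Z} {x. pair_val x \<zero> \<in> Z}" for Z c
  have "{c. \<exists>Z\<in>SS. Q Z c} \<in> SS"
    unfolding Q_def by (intro definable_comprehension_ex definable_intros sets assms definable_Theta)
  also have "{c. \<exists>Z\<in>SS. Q Z c} = {c. \<exists>X\<in>SS. Sol X \<and> B \<subseteq> X \<and> (\<forall>x. pair_val x c \<in> M \<longrightarrow> x \<in> X)}"
  proof (intro Collect_cong iffI)
    fix c assume "\<exists>Z\<in>SS. Q Z c"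
    then obtain Z where Z: "Z \<in> SS" "Q Z c" by blast
    have "{x. pair_val x u \<in> Z} \<in> SS" for u using Z by (intro definable_comprehension definable_intros)
    then show "\<exists>X\<in>SS. Sol X \<and> B \<subseteq> X \<and> (\<forall>x. pair_val x c \<in> M \<longrightarrow> x \<in> X)"
      using Z(2) unfolding Q_def Sol_def closed_under_def \<Phi>_def
      by (intro bexI[of _ "{x. pair_val x \<zero> \<in> Z}"]) auto
  next
    fix c assume "\<exists>X\<in>SS. Sol X \<and> B \<subseteq> X \<and> (\<forall>x. pair_val x c \<in> M \<longrightarrow> x \<in> X)"
    then obtain X Y where XY: "X \<in> SS" "Y \<in> SS" "Sol X" "B \<subseteq> X" "\<forall>x. pair_val x c \<in> M \<longrightarrow> x \<in> X" "\<Theta> Y X"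
      unfolding Sol_def \<Phi>_def by blast
    let ?Z = "{n. (\<exists>x. n = pair_val x \<zero> \<and> x \<in> X) \<or> (\<exists>y. n = pair_val y \<one> \<and> y \<in> Y)}"
    have "?Z \<in> SS" using XY by (intro definable_comprehension definable_intros)
    moreover have "\<one> \<noteq> \<zero>" using Suc_not_zero(1)[of \<zero>] by simp
    then have "Q ?Z c" using XY unfolding Q_def Sol_def closed_under_def by auto
    ultimately show "\<exists>Z\<in>SS. Q Z c" by blast
  qed
  finally show ?thesis .
qed

text \<open>\<open>pair_val s x \<in> W\<close> says that \<open>x\<close> has been chosen before stage \<open>s\<close>. Encoding the stage as
  \<open>pair_val (pair_val i k) u\<close> lets every requirement \<open>(i, k)\<close> be attended to at arbitrarily late stages.\<close>

lemma stages_exist: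
  assumes B: "Sol B"
  obtains W where "W \<in> SS"
    and "\<And>s. \<exists>X\<in>SS. Sol X \<and> B \<subseteq> X \<and> (\<forall>x. pair_val s x \<in> W \<longrightarrow> x \<in> X)"
    and "\<And>s x. pair_val s x \<in> W \<Longrightarrow> pair_val (s \<oplus> \<one>) x \<in> W"
    and "\<And>s X. X \<in> SS \<Longrightarrow> Sol X \<Longrightarrow> B \<subseteq> X \<Longrightarrow> s \<in> X \<Longrightarrow> (\<And>x. pair_val s x \<in> W \<Longrightarrow> x \<in> X) \<Longrightarrow>
        pair_val (s \<oplus> \<one>) s \<in> W"
    and "\<And>s i k u. s = pair_val (pair_val i k) u \<Longrightarrow> pair_val i k \<in> F \<Longrightarrow> (\<And>x. canon_val x k \<Longrightarrow> pair_val s x \<in> W) \<Longrightarrow>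
        \<exists>w. pair_val (s \<oplus> \<one>) w \<in> W \<and> pair_val w i \<in> S"
proof -
  obtain M where M: "M \<in> SS" "\<And>x. pair_val x \<zero> \<notin> M" "\<And>x c y. pair_val x (cons c y) \<in> M \<longleftrightarrow> x = y \<or> pair_val x c \<in> M"
    using finite_set_codes by blast
  define P where "P = {c. \<exists>X\<in>SS. Sol X \<and> B \<subseteq> X \<and> (\<forall>x. pair_val x c \<in> M \<longrightarrow> x \<in> X)}"
  have P: "P \<in> SS" unfolding P_def by (rule extendible_codes) fact
  \<comment> \<open>\<open>R s c c'\<close>: the code \<open>c'\<close> is an admissible successor
    of \<open>c\<close> at stage \<open>s\<close>. It is extendible, keeps the elements of
    \<open>c\<close>, contains \<open>s\<close> if possible, and meets the requirement of the stage
    if its premise lies in \<open>c\<close>.\<close>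
  define R where "R s c c' \<longleftrightarrow> c' \<in> P \<and> (\<forall>x. pair_val x c \<in> M \<longrightarrow> pair_val x c' \<in> M) \<and> (cons c s \<in> P \<longrightarrow> pair_val s c' \<in> M) \<and>
    (\<forall>i k u. s = pair_val (pair_val i k) u \<and> pair_val i k \<in> F \<and> (\<forall>x. canon_val x k \<longrightarrow> pair_val x c \<in> M) \<longrightarrow>
        (\<exists>w. pair_val w c' \<in> M \<and> pair_val w i \<in> S))" for s c c'
  have R_ex: "\<exists>c'. R s c c'" if "c \<in> P" for s c
  proof -
    define c1 where "c1 = (if cons c s \<in> P then cons c s else c)"
    have "c1 \<in> P" using that by (simp add: c1_def)
    then obtain X where X: "X \<in> SS" "Sol X" "B \<subseteq> X" "\<And>x. pair_val x c1 \<in> M \<Longrightarrow> x \<in> X" unfolding P_def by blast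
    have c1: "pair_val x c1 \<in> M" if "pair_val x c \<in> M" for x using that by (simp add: c1_def M(3))
    have c1s: "cons c s \<in> P \<Longrightarrow> pair_val s c1 \<in> M" by (simp add: c1_def M(3))
    show ?thesis
    proof (cases "\<exists>i k u. s = pair_val (pair_val i k) u \<and> pair_val i k \<in> F \<and> (\<forall>x. canon_val x k \<longrightarrow> pair_val x c \<in> M)")
      case True
      then obtain i k u where iku: "s = pair_val (pair_val i k) u" "pair_val i k \<in> F" "\<forall>x. canon_val x k \<longrightarrow> pair_val x c \<in> M" by blast
      \<comment> \<open>The premise lies in \<open>c\<close>, hence in the solution
        \<open>X\<close>, which is closed and so contains some \<open>w\<close> as required. The
        same \<open>X\<close> shows that adding \<open>w\<close> preserves extendibility.\<close>
      then obtain w where w: "w \<in> X" "pair_val w i \<in> S"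
        using X c1 unfolding Sol_def closed_under_def by blast
      have "cons c1 w \<in> P" using X w unfolding P_def by (auto simp: M(3))
      moreover have "pair_val w (cons c1 w) \<in> M" by (simp add: M(3))
      ultimately have "R s c (cons c1 w)" unfolding R_def iku(1) pair_val_inject
        using c1 c1s w iku by (auto simp: M(3))
      then show ?thesis by blast
    next
      case False
      then have "R s c c1" unfolding R_def using c1 c1s \<open>c1 \<in> P\<close> by blast
      then show ?thesis by blast
    qed
  qed
  define RR where "RR = {n. \<exists>s c c'. n = pair_val (pair_val s c) c' \<and> R s c c'}"
  have RR: "RR \<in> SS"
    unfolding RR_def R_def cons_def by (intro definable_comprehension definable_intros P M(1) sets)
  have R_iff: "R s c c' \<longleftrightarrow> pair_val (pair_val s c) c' \<in> RR" for s c c' by (simp add: RR_def)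
  \<comment> \<open>Taking the least admissible code makes the choice a function definable in the
    model.\<close>
  define step where "step s c c' \<longleftrightarrow> pair_val (pair_val s c) c' \<in> RR \<and> (\<forall>d. d \<prec> c' \<longrightarrow> pair_val (pair_val s c) d \<notin> RR)" for s c c'
  have step_ex: "\<exists>c'. step s c c'" if "c \<in> P" for s c
  proof -
    obtain c' where "pair_val (pair_val s c) c' \<in> RR" using R_ex[OF \<open>c \<in> P\<close>] R_iff by blast
    then show ?thesis
      unfolding step_def by (intro least_number[where P = "\<lambda>c'. pair_val (pair_val s c) c' \<in> RR"] definable_intros RR)
  qed
  have step_unique: "step s c c' \<Longrightarrow> step s c c'' \<Longrightarrow> c' = c''" for s c c' c''
    unfolding step_def using linear by blast
  \<comment> \<open>The recursion starting from the empty set, coded by 0, as an operator whose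
    fixed point is the graph of the sequence.\<close>
  define \<Gamma> where "\<Gamma> Z n \<longleftrightarrow> n = pair_val \<zero> \<zero> \<or> (\<exists>s c c'. n = pair_val (s \<oplus> \<one>) c' \<and> pair_val s c \<in> Z \<and> step s c c')" for Z n
  have "\<exists>I\<in>SS. \<forall>x. x \<in> I \<longleftrightarrow> \<Gamma> I x"
  proof (rule inductive_definition)
    show "definable (\<lambda>Z e. \<Gamma> Z (e 0))" unfolding \<Gamma>_def step_def by (intro definable_intros RR)
  qed (auto simp: \<Gamma>_def)
  then obtain H where H: "H \<in> SS" "\<And>x. x \<in> H \<longleftrightarrow> \<Gamma> H x" by blast
  have H0: "pair_val \<zero> c \<in> H \<longleftrightarrow> c = \<zero>" for c
    by (subst H(2)) (simp add: \<Gamma>_def)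
  have HS: "pair_val (s \<oplus> \<one>) c' \<in> H \<longleftrightarrow> (\<exists>c. pair_val s c \<in> H \<and> step s c c')" for s c'
    by (subst H(2)) (simp add: \<Gamma>_def)
  have H_fun: "\<exists>c. c \<in> P \<and> (\<forall>c'. pair_val s c' \<in> H \<longleftrightarrow> c' = c)" for s
  proof (rule definable_induct[of _ s])
    show "definable (\<lambda>Z e. \<exists>c. c \<in> P \<and> (\<forall>c'. pair_val (e 0) c' \<in> H \<longleftrightarrow> c' = c))"
      by (intro definable_intros P H(1))
    have "\<zero> \<in> P" using B sets M(2) unfolding P_def by blast
    then show "\<exists>c. c \<in> P \<and> (\<forall>c'. pair_val \<zero> c' \<in> H \<longleftrightarrow> c' = c)" using H0 by blast
    fix s assume "\<exists>c. c \<in> P \<and> (\<forall>c'. pair_val s c' \<in> H \<longleftrightarrow> c' = c)"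
    then obtain c where c: "c \<in> P" "\<And>c'. pair_val s c' \<in> H \<longleftrightarrow> c' = c" by blast
    obtain d where d: "step s c d" using step_ex c(1) by blast
    then have "d \<in> P" unfolding step_def using R_iff R_def by blast
    moreover have "pair_val (s \<oplus> \<one>) c' \<in> H \<longleftrightarrow> c' = d" for c'
      unfolding HS c(2) using d step_unique by blast
    ultimately show "\<exists>c. c \<in> P \<and> (\<forall>c'. pair_val (s \<oplus> \<one>) c' \<in> H \<longleftrightarrow> c' = c)" by blast
  qed
  then obtain h where h: "\<And>s. h s \<in> P" "\<And>s c. pair_val s c \<in> H \<longleftrightarrow> c = h s" by metis
  have Rh: "R s (h s) (h (s \<oplus> \<one>))" for s
    using HS[of s "h (s \<oplus> \<one>)"] unfolding h(2) by (auto simp: step_def R_iff)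
  \<comment> \<open>\<open>W\<close> is defined from the set \<open>H\<close>; the function
    \<open>h\<close>, chosen outside the model, only abbreviates its values.\<close>
  define W where "W = {n. \<exists>s x c. n = pair_val s x \<and> pair_val s c \<in> H \<and> pair_val x c \<in> M}"
  have "W \<in> SS" unfolding W_def by (intro definable_comprehension definable_intros H(1) M(1))
  have W: "pair_val s x \<in> W \<longleftrightarrow> pair_val x (h s) \<in> M" for s x by (auto simp: W_def h(2))
  show ?thesis
  proof (rule that[OF \<open>W \<in> SS\<close>])
    show "\<exists>X\<in>SS. Sol X \<and> B \<subseteq> X \<and> (\<forall>x. pair_val s x \<in> W \<longrightarrow> x \<in> X)" for s
      using h(1)[of s] unfolding P_def W by blast
    show "pair_val (s \<oplus> \<one>) x \<in> W" if "pair_val s x \<in> W" for s x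
      using that Rh[of s] unfolding W R_def by blast
    show "pair_val (s \<oplus> \<one>) s \<in> W"
      if "X \<in> SS" "Sol X" "B \<subseteq> X" "s \<in> X" "\<And>x. pair_val s x \<in> W \<Longrightarrow> x \<in> X" for s X
    proof -
      have "cons (h s) s \<in> P" unfolding P_def using that unfolding W by (auto simp: M(3))
      then show ?thesis using Rh[of s] unfolding W R_def by blast
    qed
    show "\<exists>w. pair_val (s \<oplus> \<one>) w \<in> W \<and> pair_val w i \<in> S"
      if "s = pair_val (pair_val i k) u" "pair_val i k \<in> F" "\<And>x. canon_val x k \<Longrightarrow> pair_val s x \<in> W" for s i k u
      using that Rh[of s] unfolding W R_def by blast
  qed
qed

text \<open>A set bounded in the model may be infinite from outside, so a finite subset of the union
  cannot be caught at one stage by counting its elements; induction in the model has to do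
  this.\<close>

lemma maximal_solution_exists:
  assumes B: "Sol B"
    and fc: "\<And>X. X \<in> SS \<Longrightarrow> \<Phi> X \<longleftrightarrow> (\<forall>Y\<in>SS. (\<exists>b. \<forall>x. x \<in> Y \<longrightarrow> x \<prec> b) \<and> Y \<subseteq> X \<longrightarrow> \<Phi> Y)"
  shows "\<exists>C\<in>SS. B \<subseteq> C \<and> Sol C \<and> (\<forall>D\<in>SS. Sol D \<and> C \<subseteq> D \<longrightarrow> D \<subseteq> C)"
proof -
  obtain W where W: "W \<in> SS"
    and extendible: "\<And>s. \<exists>X\<in>SS. Sol X \<and> B \<subseteq> X \<and> (\<forall>x. pair_val s x \<in> W \<longrightarrow> x \<in> X)"
    and W_Suc: "\<And>s x. pair_val s x \<in> W \<Longrightarrow> pair_val (s \<oplus> \<one>) x \<in> W"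
    and decide: "\<And>s X. X \<in> SS \<Longrightarrow> Sol X \<Longrightarrow> B \<subseteq> X \<Longrightarrow> s \<in> X \<Longrightarrow> (\<And>x. pair_val s x \<in> W \<Longrightarrow> x \<in> X) \<Longrightarrow>
        pair_val (s \<oplus> \<one>) s \<in> W"
    and witness: "\<And>s i k u. s = pair_val (pair_val i k) u \<Longrightarrow> pair_val i k \<in> F \<Longrightarrow> (\<And>x. canon_val x k \<Longrightarrow> pair_val s x \<in> W) \<Longrightarrow>
        \<exists>w. pair_val (s \<oplus> \<one>) w \<in> W \<and> pair_val w i \<in> S"
    by (rule stages_exist[OF B]) blast
  have W_add: "pair_val s x \<in> W \<longrightarrow> pair_val (s \<oplus> t) x \<in> W" for s t x
    by (rule definable_induct[of _ t]) (intro definable_intros W, use W_Suc in \<open>auto simp: add_Suc\<close>)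
  have W_less: "s \<prec> t \<Longrightarrow> pair_val s x \<in> W \<Longrightarrow> pair_val t x \<in> W" for s t x
    unfolding less_iff using W_add by blast
  define C where "C = {x. \<exists>s. pair_val s x \<in> W}"
  have C: "C \<in> SS" unfolding C_def by (intro definable_comprehension definable_intros W)
  \<comment> \<open>Induction on the bound: the new element costs at most one further stage, and the
    later of the two stages serves for all.\<close>
  have bounded: "\<exists>s. \<forall>x. x \<in> Y \<and> x \<prec> b \<longrightarrow> pair_val s x \<in> W" if Y: "Y \<in> SS" "Y \<subseteq> C" for Y b
  proof (rule definable_induct[of _ b])
    show "definable (\<lambda>Z e. \<exists>s. \<forall>x. x \<in> Y \<and> x \<prec> e 0 \<longrightarrow> pair_val s x \<in> W)"
      by (intro definable_intros W Y)
    fix b assume "\<exists>s. \<forall>x. x \<in> Y \<and> x \<prec> b \<longrightarrow> pair_val s x \<in> W"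
    then obtain s where s: "\<And>x. x \<in> Y \<Longrightarrow> x \<prec> b \<Longrightarrow> pair_val s x \<in> W" by blast
    obtain t where t: "b \<in> Y \<Longrightarrow> pair_val t b \<in> W" using Y by (auto simp: C_def)
    consider "s = t" | "s \<prec> t" | "t \<prec> s" using linear by blast
    then show "\<exists>s. \<forall>x. x \<in> Y \<and> x \<prec> b \<oplus> \<one> \<longrightarrow> pair_val s x \<in> W"
    proof cases
      case 1 then show ?thesis using s t by (auto simp: less_Suc)
    next
      case 2 then show ?thesis using s t W_less by (intro exI[of _ t]) (auto simp: less_Suc)
    next
      case 3 then show ?thesis using s t W_less by (intro exI[of _ s]) (auto simp: less_Suc)
    qed
  qed auto
  \<comment> \<open>Each \<open>b\<close> of \<open>B\<close> is adopted at its own stage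
    \<open>b\<close>, since every solution extending that stage contains \<open>B\<close>.\<close>
  have "B \<subseteq> C"
  proof
    fix b assume "b \<in> B"
    moreover obtain X where "X \<in> SS" "Sol X" "B \<subseteq> X" "\<And>x. pair_val b x \<in> W \<Longrightarrow> x \<in> X"
      using extendible by blast
    ultimately show "b \<in> C" unfolding C_def using decide by blast
  qed
  moreover have "\<exists>w. w \<in> C \<and> pair_val w i \<in> S" if ik: "pair_val i k \<in> F" "\<forall>x. canon_val x k \<longrightarrow> x \<in> C" for i k
  proof -
    have "{x. canon_val x k} \<in> SS" by (intro definable_comprehension definable_intros)
    from bounded[OF this, of k] ik(2) obtain s where s: "\<And>x. canon_val x k \<Longrightarrow> pair_val s x \<in> W"
      using canon_val_less by blast
    \<comment> \<open>With \<open>s\<close> as the free component, the requirement comes up at or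
      after stage \<open>s\<close>, when its whole premise is already present.\<close>
    obtain t where t: "pair_val (pair_val i k) s = s \<oplus> t" using pair_val_ge by blast
    from s W_add[of s _ t] have "\<exists>w. pair_val (pair_val (pair_val i k) s \<oplus> \<one>) w \<in> W \<and> pair_val w i \<in> S"
      by (intro witness[OF refl ik(1)]) (simp add: t)
    then show ?thesis unfolding C_def by blast
  qed
  then have "closed_under C" unfolding closed_under_def by blast
  moreover have "C \<subseteq> A"
    using extendible unfolding C_def Sol_def by blast
  moreover have "\<Phi> Y" if Y: "Y \<in> SS" "Y \<subseteq> C" "\<forall>x. x \<in> Y \<longrightarrow> x \<prec> b" for Y b
  proof -
    from bounded[OF Y(1,2), of b] obtain s where s: "\<And>x. x \<in> Y \<Longrightarrow> pair_val s x \<in> W" using Y(3) by blast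
    from extendible[of s] obtain X where X: "X \<in> SS" "Sol X" "\<And>x. pair_val s x \<in> W \<Longrightarrow> x \<in> X" by blast
    then have "\<Phi> X" "Y \<subseteq> X" using s by (auto simp: Sol_def)
    \<comment> \<open>Finite character is used downwards, from the solution \<open>X\<close>
      extending stage \<open>s\<close> to its bounded subset \<open>Y\<close>; the converse
      direction will then give \<open>\<Phi> C\<close>.\<close>
    then show ?thesis using iffD1[OF fc[OF X(1)]] Y(1,3) by auto
  qed
  then have "\<Phi> C" by (intro iffD2[OF fc[OF C]]) auto
  moreover have "D \<subseteq> C" if D: "D \<in> SS" "Sol D" "C \<subseteq> D" for D
  proof
    fix d assume "d \<in> D"
    \<comment> \<open>The competitor \<open>D\<close> itself witnesses that adding \<open>d\<close>
      at stage \<open>d\<close> was possible.\<close>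
    then have "pair_val (d \<oplus> \<one>) d \<in> W" using D \<open>B \<subseteq> C\<close> by (intro decide) (auto simp: C_def)
    then show "d \<in> C" by (auto simp: C_def)
  qed
  ultimately show ?thesis using C unfolding Sol_def by blast
qed

end

section \<open>Evaluation of the closure extension formulas in the model\<close>

context Pi11_model
begin

lemma sat_fm_at [simp]: "sat e E (fm_at \<phi> k X) \<longleftrightarrow> sat e (case_nat (E X) (\<lambda>i. E (i + k))) \<phi>"
proof -
  have "(\<lambda>i. E (case_nat X (\<lambda>i. i + k) i)) = case_nat (E X) (\<lambda>i. E (i + k))"
    by (auto simp: fun_eq_iff split: nat.split)
  then show ?thesis by (simp add: fm_at_def sat_subst)
qed

lemma val_pair [simp]: "val e (pair s t) = pair_val (val e s) (val e t)"
  by (simp add: pair_def pair_val_def)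

lemma sat_subset_set [simp]: "sat e E (subset_set X Y) \<longleftrightarrow> E X \<subseteq> E Y"
  by (auto simp: subset_set_def)

lemma sat_finite_set [simp]: "sat e E (finite_set X) \<longleftrightarrow> (\<exists>b. \<forall>x. x \<in> E X \<longrightarrow> x \<prec> b)"
  by (simp add: finite_set_def)

lemma sat_closed_set:
  "sat e E (closed_set F S X) \<longleftrightarrow> (\<forall>i k. pair_val i k \<in> E F \<longrightarrow> (\<forall>x. canon_val x k \<longrightarrow> x \<in> E X) \<longrightarrow>
     (\<exists>w. w \<in> E X \<and> pair_val w i \<in> E S))"
  by (simp add: closed_set_def sat_canon_mem eval_nat_numeral)

lemma sat_NCE:
  assumes \<theta>: "arithmetical \<theta>" and E: "range E \<subseteq> SS"
  shows "sat e E (NCE (ExS \<theta>))"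
proof -
  have E' [simp]: "E i \<in> SS" for i using E by auto
  define \<Theta> where "\<Theta> Y X \<longleftrightarrow> sat e (case_nat Y (case_nat X E)) \<theta>" for Y X
  define \<phi> where "\<phi> = ExS \<theta>"
  have \<Theta>: "sat e (case_nat X E) \<phi> \<longleftrightarrow> (\<exists>Y\<in>SS. \<Theta> Y X)" for X
    by (simp add: \<Theta>_def \<phi>_def)
  define sol where "sol F S A X \<longleftrightarrow> (\<forall>i k. pair_val i k \<in> F \<longrightarrow> (\<forall>x. canon_val x k \<longrightarrow> x \<in> X) \<longrightarrow>
     (\<exists>w. w \<in> X \<and> pair_val w i \<in> S)) \<and> X \<subseteq> A \<and> (\<exists>Y\<in>SS. \<Theta> Y X)" for F S A X
  \<comment> \<open>Under \<open>k\<close> set quantifiers the shift in \<open>fm_at\<close> skips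
    the new sets, so the parameters keep their values.\<close>
  have solution: "sat e E' (solution \<phi> k F S A X) \<longleftrightarrow> sol (E' F) (E' S) (E' A) (E' X)"
    if "\<And>i. E' (i + k) = E i" for E' k F S A X
    unfolding solution_def sol_def by (simp add: sat_closed_set that \<Theta>)
  have finite_character: "(\<exists>Z\<in>SS. \<Theta> Z X) \<longleftrightarrow>
      (\<forall>Y\<in>SS. (\<exists>b. \<forall>x. x \<in> Y \<longrightarrow> x \<prec> b) \<and> Y \<subseteq> X \<longrightarrow> (\<exists>Z\<in>SS. \<Theta> Z Y))"
    if "sat e E (finite_character \<phi>)" "X \<in> SS" for X
  proof -
    have "\<forall>X\<in>SS. sat e (case_nat X E) \<phi> \<longleftrightarrow>
        (\<forall>Y\<in>SS. (\<exists>b. \<forall>x. x \<in> Y \<longrightarrow> x \<prec> b) \<and> Y \<subseteq> X \<longrightarrow> sat e (case_nat Y E) \<phi>)"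
      using that(1) unfolding finite_character_def by (simp add: eval_nat_numeral) blast
    then show ?thesis using that(2) by (simp only: \<Theta>)
  qed
  have maximal: "\<exists>C\<in>SS. sol F S A C \<and> B \<subseteq> C \<and> (\<forall>D\<in>SS. C \<subseteq> D \<longrightarrow> sol F S A D \<longrightarrow> D = C)"
    if FSAB: "F \<in> SS" "S \<in> SS" "A \<in> SS" "B \<in> SS" "sol F S A B"
      and fc: "sat e E (finite_character \<phi>)" for F S A B
  proof -
    interpret closure_problem zr on pl ti ls SS F S A B \<Theta>
    proof unfold_locales
      show "definable (\<lambda>Z e. \<Theta> {x. pair_val x \<one> \<in> Z} {x. pair_val x \<zero> \<in> Z})"
        unfolding \<Theta>_def
      proof (rule definable_sat[OF \<theta> term_fun_const])
        show "definable (\<lambda>Z e. t e \<in> case_nat {x. pair_val x \<one> \<in> Z} (case_nat {x. pair_val x \<zero> \<in> Z} E) n)"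
          if "term_fun t" for n t
        proof -
          \<comment> \<open>Set variable 0 is the witness of the \<Sigma>11 formula, 1 is its
            argument, and the others are parameters interpreted by sets of the model.\<close>
          consider "n = 0" | "n = 1" | m where "n = Suc (Suc m)"
            by (metis One_nat_def not0_implies_Suc)
          then show ?thesis using that by cases (auto intro!: definable_intros)
        qed
      qed
    qed fact+
    have Sol: "Sol X \<longleftrightarrow> sol F S A X" for X
      by (simp add: Sol_def sol_def closed_under_def \<Phi>_def)
    have "Sol B" using FSAB Sol by simp
    moreover have "\<Phi> X \<longleftrightarrow> (\<forall>Y\<in>SS. (\<exists>b. \<forall>x. x \<in> Y \<longrightarrow> x \<prec> b) \<and> Y \<subseteq> X \<longrightarrow> \<Phi> Y)"
      if "X \<in> SS" for X
      using finite_character[OF fc that] by (simp add: \<Phi>_def)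
    ultimately obtain C where "C \<in> SS" "B \<subseteq> C" "Sol C"
      "\<forall>D\<in>SS. Sol D \<and> C \<subseteq> D \<longrightarrow> D \<subseteq> C"
      using maximal_solution_exists by blast
    then show ?thesis unfolding Sol by blast
  qed
  show ?thesis
    unfolding NCE_def \<phi>_def[symmetric]
    by (simp add: solution eval_nat_numeral) (intro HOL.impI ballI maximal)
qed

end

theorem theorem4p6:
  shows "\<forall>\<psi> \<in> Sigma11_NCE. Pi11_CA0 \<turnstile> \<psi>"
proof
  fix \<psi> assume "\<psi> \<in> Sigma11_NCE"
  then obtain \<theta> where \<theta>: "arithmetical \<theta>" "\<psi> = NCE (ExS \<theta>)"
    unfolding Sigma11_NCE_def Sigma11_def by blast
  show "Pi11_CA0 \<turnstile> \<psi>"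
  proof (rule Pi11_CA0.completeness)
    fix zr :: nat and on pl ti ls SS e and E :: "nat \<Rightarrow> nat set"
    assume "countable SS" and E: "range E \<subseteq> SS"
      and ax: "\<And>\<phi> e E. \<phi> \<in> Pi11_CA0 \<Longrightarrow> range E \<subseteq> SS \<Longrightarrow> second_order_structure.sat zr on pl ti ls SS e E \<phi>"
    interpret Pi11_model zr on pl ti ls SS
    proof
      show "countable SS" by fact
      show "second_order_structure.sat zr on pl ti ls SS e E \<phi>"
        if "\<phi> \<in> Pi11_CA0" "range E \<subseteq> SS" for \<phi> e E
        using that by (rule ax)
      show "SS \<noteq> {}" using E by blast
    qed
    show "sat e E \<psi>" unfolding \<theta>(2) by (rule sat_NCE) fact+
  qed (auto simp: Pi11_CA0_def)
qed

end
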